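(* Let $\mathbf{v}=(v_1,v_2)\in C^2(\mathbb{R}^2;\mathbb{R}^2)$ be a velocity field which, together with a scalar pressure $P$, is a classical solution of $$\mathbf{v}\cdot\nabla\mathbf{v}+\nabla P=0\ \text{ in }\mathbb{R}^2,\qquad \nabla\cdot\mathbf{v}=0\ \text{ in }\mathbb{R}^2 .$$ Let $\mathcal{S}=\{x\in\mathbb{R}^2:|\mathbf{v}(x)|=0\}$ be its set of stagnation points, and write $\mathbf{v}(x)=v^r(x)\mathbf{e}_r(x)+v^\theta(x)\mathbf{e}_\theta(x)$ for $x\neq0$. Assume that: (1) $\mathcal{S}=\overline{B_R}$ for some $R>0$; (2) the following far-field conditions hold: $$\liminf_{|x|\to+\infty}v^\theta(x)>0\quad\text{and}\quad v^r(x)=o\left(\frac{1}{|x|}\right)\ \text{as }|x|\to+\infty ;$$ (3) there exists a $\delta>0$ such that $v^\theta(x)>0$ for all $R<|x|<R+\delta$, and $v^r(x)=o\left(v^\theta(x)\right)$ as $|x|\to R^+$. Then $\mathbf{v}$ is a circular flow, that is, there is a $C^2(R,+\infty)$ positive function $V:(R,+\infty)\to\mathbb{R}$ such that $$\mathbf{v}(x)=V(|x|)\,\mathbf{e}_\theta(x)\quad\text{for all }|x|>R .$$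
   Context: $B_R=\{x\in\mathbb{R}^2:|x|<R\}$ is the open disk of radius $R$ centered at the origin, and $\overline{B_R}$ its closure. For $x=(x_1,x_2)\in\mathbb{R}^2\setminus\{0\}$, $\mathbf{e}_r(x)=\frac{x}{|x|}$ and $\mathbf{e}_\theta(x)=\left(-\frac{x_2}{|x|},\frac{x_1}{|x|}\right)$; thus $v^r=\mathbf{v}\cdot\mathbf{e}_r$ and $v^\theta=\mathbf{v}\cdot\mathbf{e}_\theta$ are the radial and angular velocities. Solutions are understood in the classical sense: both $\mathbf{v}$ and $P$ are at least of class $C^1$ and satisfy the equations pointwise. *)

theory Defs
  imports "HOL-Analysis.Analysis" "HOL-Library.Landau_Symbols"
begin

text \<open>Functions of class \<open>C\<^sup>k\<close> on an \<^emph>\<open>open\<close> set \<open>S\<close>. Differentiability is taken at each point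
  with respect to the whole space, which is the intended notion only when \<open>S\<close> is open.\<close>

fun C_k_on :: "nat \<Rightarrow> ('a::real_normed_vector \<Rightarrow> 'b::real_normed_vector) \<Rightarrow> 'a set \<Rightarrow> bool" where
  "C_k_on 0 f S \<longleftrightarrow> continuous_on S f"
| "C_k_on (Suc k) f S \<longleftrightarrow>
     (\<forall>x\<in>S. f differentiable (at x)) \<and>
     (\<forall>h. C_k_on k (\<lambda>x. frechet_derivative f (at x) h) S)"

definition partial_deriv :: "2 \<Rightarrow> (real^2 \<Rightarrow> 'b::real_normed_vector) \<Rightarrow> real^2 \<Rightarrow> 'b" where
  "partial_deriv j f x = frechet_derivative f (at x) (axis j 1)"

definition gradient :: "(real^2 \<Rightarrow> real) \<Rightarrow> real^2 \<Rightarrow> real^2" where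
  "gradient p x = (\<chi> j. partial_deriv j p x)"

definition divergence :: "(real^2 \<Rightarrow> real^2) \<Rightarrow> real^2 \<Rightarrow> real" where
  "divergence v x = (\<Sum>j\<in>UNIV. partial_deriv j v x $ j)"

definition convection :: "(real^2 \<Rightarrow> real^2) \<Rightarrow> real^2 \<Rightarrow> real^2" where
  "convection v x = (\<Sum>j\<in>UNIV. (v x $ j) *\<^sub>R partial_deriv j v x)"

definition classical_Euler_solution :: "(real^2 \<Rightarrow> real^2) \<Rightarrow> (real^2 \<Rightarrow> real) \<Rightarrow> bool" where
  "classical_Euler_solution v p \<longleftrightarrow>
     C_k_on 1 v UNIV \<and> C_k_on 1 p UNIV \<and>
     (\<forall>x. convection v x + gradient p x = 0) \<and>
     (\<forall>x. divergence v x = 0)"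

definition stagnation_set :: "(real^2 \<Rightarrow> real^2) \<Rightarrow> (real^2) set" where
  "stagnation_set v = {x. norm (v x) = 0}"

text \<open>The polar frame is meaningful only for \<open>x \<noteq> 0\<close>; both vectors take the junk value \<open>0\<close> at
  the origin.\<close>

definition e_r :: "real^2 \<Rightarrow> real^2" where
  "e_r x = x /\<^sub>R norm x"

definition e_theta :: "real^2 \<Rightarrow> real^2" where
  "e_theta x = vector [- (x $ 2) / norm x, x $ 1 / norm x]"

definition radial_velocity :: "(real^2 \<Rightarrow> real^2) \<Rightarrow> real^2 \<Rightarrow> real" where
  "radial_velocity v x = v x \<bullet> e_r x"

definition angular_velocity :: "(real^2 \<Rightarrow> real^2) \<Rightarrow> real^2 \<Rightarrow> real" where
  "angular_velocity v x = v x \<bullet> e_theta x"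

end

theory Submission
  imports Defs
begin

text \<open>
  The velocity field is \<open>v = rot90 (\<nabla>u)\<close> for a stream function \<open>u\<close>, normalised to vanish in the disk,
  where it is constant. Then \<open>v\<^sup>\<theta> = u\<^sub>r\<close> and \<open>|x| v\<^sup>r = -u\<^sub>\<theta>\<close>, the Laplacian \<open>\<omega> = \<Delta>u\<close> is constant along
  the flow, \<open>u\<close> has no critical point outside the disk, and \<open>u\<close> tends to infinity at infinity. The
  claim is that \<open>u\<close> is radial, and this follows from the method of moving planes.

  First, \<open>\<Delta>u\<close> is a function of \<open>u\<close> outside the disk. For this the level sets of \<open>u\<close> at positive
  levels must be connected: the sub- and superlevel sets are connected because there are no
  critical points, and the plane is unicoherent (\<open>connected_level_set\<close>). As \<open>\<omega>\<close> is locally constant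
  on level sets, it is constant on each of them, and \<open>\<Delta>u = f(u)\<close> with \<open>f\<close> locally Lipschitz on the
  positive reals (\<open>vorticity_Lipschitz_in_stream_function\<close>).

  Second, the conditions near the disk and at infinity imply that \<open>u\<^sub>\<theta>\<close> is negligible compared
  with \<open>u\<^sub>r\<close> at both ends. For a line at a fixed positive distance from the origin and a point
  \<open>x\<close> beyond it, near either end, this gives \<open>u(x') < u(x)\<close> directly, where \<open>x'\<close> is the reflection
  of \<open>x\<close>: unless \<open>x'\<close> lies in the disk or in a bounded region with smaller values, one moves from \<open>x'\<close>
  to \<open>x\<close> along a spiral on which \<open>u\<close> increases (\<open>reflection_decreases_at_ends\<close>). In this way the
  behaviour of \<open>f\<close> at \<open>0\<close>, where it need not be Lipschitz, and the lack of compactness play no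
  role.

  Third, the line is moved from infinity towards the origin. In the remaining compact region the
  inequality \<open>u(x') < u(x)\<close> persists by the strong maximum principle and Hopf's lemma for the
  difference, down to every line not passing through the origin (\<open>reflection_decreases\<close>). In the
  limit, \<open>u\<close> is invariant under all reflections in lines through the origin.
\<close>

section \<open>Calculus in normed spaces\<close>

lemma continuous_on_if_has_derivative:
  assumes "\<And>x. (f has_derivative F x) (at x)"
  shows "continuous_on S f"
  by (intro continuous_at_imp_continuous_on ballI has_derivative_continuous[OF assms])

lemma has_real_derivative_along_line:
  fixes f :: "'a::real_normed_vector \<Rightarrow> real"
  assumes "(f has_derivative D) (at (x + s *\<^sub>R h))"
  shows "((\<lambda>t. f (x + t *\<^sub>R h)) has_real_derivative D h) (at s)"
proof -
  have 1: "((\<lambda>t. x + t *\<^sub>R h) has_derivative (\<lambda>t. t *\<^sub>R h)) (at s)"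
    by (auto intro!: derivative_eq_intros)
  show ?thesis
    unfolding has_field_derivative_def
    by (rule has_derivative_eq_rhs[OF has_derivative_compose[OF 1 assms]])
      (simp add: fun_eq_iff linear_scale[OF has_derivative_linear[OF assms]])
qed

text \<open>Schwarz's theorem for two directions of differentiation. It applies to the components of the
  velocity, and also to the pressure, whose gradient is \<open>C\<^sup>1\<close> by the Euler equation.\<close>
lemma mixed_derivatives_commute:
  fixes f :: "'a::real_normed_vector \<Rightarrow> real"
  assumes f: "\<And>x. (f has_derivative f' x) (at x)"
    and fh: "\<And>x. ((\<lambda>x. f' x h) has_derivative D1 x) (at x)"
    and fk: "\<And>x. ((\<lambda>x. f' x k) has_derivative D2 x) (at x)"
    and c1: "continuous_on UNIV (\<lambda>x. D1 x k)"
    and c2: "continuous_on UNIV (\<lambda>x. D2 x h)"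
  shows "D1 x k = D2 x h"
proof -
  \<comment> \<open>The second difference of \<open>f\<close> is computed by the mean value theorem in either order.\<close>
  have second_difference: "\<exists>s t. 0 < s \<and> s < e \<and> 0 < t \<and> t < e \<and>
      f (x + e *\<^sub>R h + e *\<^sub>R k) - f (x + e *\<^sub>R h) - f (x + e *\<^sub>R k) + f x
        = e\<^sup>2 * D (x + s *\<^sub>R h + t *\<^sub>R k) k"
    if "e > 0" and D: "\<And>x. ((\<lambda>x. f' x h) has_derivative D x) (at x)" for e D h k
  proof -
    define g where "g = (\<lambda>s. f (x + s *\<^sub>R h + e *\<^sub>R k) - f (x + s *\<^sub>R h))"
    have lin: "f' y (c *\<^sub>R w) = c * f' y w" for y c w
      using linear_scale[OF has_derivative_linear[OF f[of y]], of c w] by simp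
    have g': "(g has_real_derivative (f' (x + s *\<^sub>R h + e *\<^sub>R k) h - f' (x + s *\<^sub>R h) h)) (at s)" for s
      unfolding g_def has_field_derivative_def
      by (auto intro!: derivative_eq_intros has_derivative_compose[OF _ f] simp: lin fun_eq_iff algebra_simps simp del: add.assoc)
    obtain s where s: "0 < s" "s < e" "g e - g 0 = e * (f' (x + s *\<^sub>R h + e *\<^sub>R k) h - f' (x + s *\<^sub>R h) h)"
      using MVT2[of 0 e g] g' \<open>e > 0\<close> by force
    define q where "q = (\<lambda>t. f' (x + s *\<^sub>R h + t *\<^sub>R k) h)"
    have q': "(q has_real_derivative (D (x + s *\<^sub>R h + t *\<^sub>R k) k)) (at t)" for t
      unfolding q_def by (intro has_real_derivative_along_line D)
    obtain t where t: "0 < t" "t < e" "q e - q 0 = e * D (x + s *\<^sub>R h + t *\<^sub>R k) k"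
      using MVT2[of 0 e q] q' \<open>e > 0\<close> by force
    show ?thesis
      using s t by (intro exI[of _ s] exI[of _ t]) (simp add: g_def q_def power2_eq_square)
  qed
  show ?thesis
  proof (rule ccontr)
    assume ne: "D1 x k \<noteq> D2 x h"
    define d where "d = \<bar>D1 x k - D2 x h\<bar> / 2"
    have "d > 0" using ne by (simp add: d_def)
    obtain r1 where r1: "r1 > 0" "\<And>y. dist y x < r1 \<Longrightarrow> dist (D1 y k) (D1 x k) < d"
      using c1 \<open>d > 0\<close> unfolding continuous_on_iff by (metis UNIV_I)
    obtain r2 where r2: "r2 > 0" "\<And>y. dist y x < r2 \<Longrightarrow> dist (D2 y h) (D2 x h) < d"
      using c2 \<open>d > 0\<close> unfolding continuous_on_iff by (metis UNIV_I)
    define e where "e = min r1 r2 / (norm h + norm k + 1)"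
    have e: "e > 0" using r1 r2 by (auto simp: e_def add_nonneg_pos)
    have small: "norm (s *\<^sub>R h + t *\<^sub>R k) < min r1 r2" if "0 < s" "s < e" "0 < t" "t < e" for s t
    proof -
      have "norm (s *\<^sub>R h + t *\<^sub>R k) \<le> s * norm h + t * norm k"
        using that norm_triangle_ineq[of "s *\<^sub>R h" "t *\<^sub>R k"] by simp
      also have "\<dots> \<le> e * norm h + e * norm k"
        using that by (intro add_mono mult_right_mono) auto
      also have "\<dots> < e * (norm h + norm k + 1)"
        using e by (simp add: algebra_simps)
      also have "\<dots> = min r1 r2" unfolding e_def by (simp add: add_nonneg_pos less_imp_neq[symmetric] add_pos_nonneg)
      finally show ?thesis .
    qed
    obtain s t where st: "0 < s" "s < e" "0 < t" "t < e"
      "f (x + e *\<^sub>R h + e *\<^sub>R k) - f (x + e *\<^sub>R h) - f (x + e *\<^sub>R k) + f x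
        = e\<^sup>2 * D1 (x + s *\<^sub>R h + t *\<^sub>R k) k"
      using second_difference[OF e fh] by blast
    obtain s' t' where st': "0 < s'" "s' < e" "0 < t'" "t' < e"
      "f (x + e *\<^sub>R k + e *\<^sub>R h) - f (x + e *\<^sub>R k) - f (x + e *\<^sub>R h) + f x
        = e\<^sup>2 * D2 (x + s' *\<^sub>R k + t' *\<^sub>R h) h"
      using second_difference[OF e fk] by blast
    have "D1 (x + s *\<^sub>R h + t *\<^sub>R k) k = D2 (x + s' *\<^sub>R k + t' *\<^sub>R h) h"
      using st(5) st'(5) e by (simp add: algebra_simps)
    moreover have "dist (D1 (x + s *\<^sub>R h + t *\<^sub>R k) k) (D1 x k) < d"
      using small[OF st(1-4)] by (intro r1) (simp add: dist_norm add.assoc)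
    moreover have "dist (D2 (x + s' *\<^sub>R k + t' *\<^sub>R h) h) (D2 x h) < d"
      using small[OF st'(3,4,1,2)] by (intro r2) (simp add: dist_norm add_ac)
    ultimately show False
      unfolding d_def dist_real_def by (smt (verit) field_sum_of_halves)
  qed
qed

text \<open>The Poincare lemma for a \<open>C\<^sup>1\<close> vector field on the whole space with symmetric derivative;
  the potential is \<open>u(x) = \<integral>\<^sub>0\<^sup>1 a(t x) \<bullet> x dt\<close>.\<close>
lemma gradient_of_symmetric_derivative:
  fixes a :: "'a::euclidean_space \<Rightarrow> 'a"
  assumes a: "\<And>x. (a has_derivative A x) (at x)"
    and cont: "continuous_on UNIV (\<lambda>(x, h). A x h)"
    and sym: "\<And>x h k. A x h \<bullet> k = A x k \<bullet> h"
  shows "\<exists>u. u 0 = 0 \<and> (\<forall>x. (u has_derivative (\<lambda>h. a x \<bullet> h)) (at x))"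
proof -
  have conta: "continuous_on UNIV a"
    by (rule continuous_on_if_has_derivative[OF a])
  note ca = continuous_on_compose2[OF conta _ subset_UNIV]
  have cA: "continuous_on S (\<lambda>p. A (f p) (g p))" if "continuous_on S f" "continuous_on S g"
    for S and f g :: "'c::topological_space \<Rightarrow> 'a"
    using continuous_on_compose2[OF cont continuous_on_Pair[OF that] subset_UNIV] by simp
  define u where "u = (\<lambda>x. integral (cbox 0 (1::real)) (\<lambda>t. a (t *\<^sub>R x) \<bullet> x))"
  define G where "G = (\<lambda>x (t::real). a (t *\<^sub>R x) + t *\<^sub>R A (t *\<^sub>R x) x)"
  have lin: "A y (c *\<^sub>R w) = c *\<^sub>R A y w" for y c w
    using linear_scale[OF has_derivative_linear[OF a[of y]]] .
  have fx: "((\<lambda>x. a (t *\<^sub>R x) \<bullet> x) has_derivative blinfun_apply (blinfun_inner_right (G x t))) (at x within UNIV)" for x t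
  proof -
    have "((\<lambda>x. a (t *\<^sub>R x) \<bullet> x) has_derivative (\<lambda>h. a (t *\<^sub>R x) \<bullet> h + A (t *\<^sub>R x) (t *\<^sub>R h) \<bullet> x)) (at x)"
      by (auto intro!: derivative_eq_intros has_derivative_compose[OF _ a])
    moreover have "(\<lambda>h. a (t *\<^sub>R x) \<bullet> h + A (t *\<^sub>R x) (t *\<^sub>R h) \<bullet> x) = blinfun_inner_right (G x t)"
      by (rule ext, subst sym) (simp add: G_def lin inner_add_left)
    ultimately show ?thesis by simp
  qed
  have cG: "continuous_on (UNIV \<times> cbox 0 1) (\<lambda>(x, t). blinfun_inner_right (G x t))"
    unfolding split_def G_def by (intro continuous_intros ca cA)
  have "(u has_derivative blinfun_apply (integral (cbox 0 1) (\<lambda>t. blinfun_inner_right (G x t)))) (at x within UNIV)" for x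
    unfolding u_def
    by (rule leibniz_rule[OF fx _ cG]) (intro integrable_continuous continuous_intros ca UNIV_I convex_UNIV)+
  moreover have "integral (cbox 0 1) (\<lambda>t. blinfun_inner_right (G x t)) = blinfun_inner_right (a x)" for x
  proof -
    have "(G x has_integral (1 *\<^sub>R a (1 *\<^sub>R x) - 0 *\<^sub>R a (0 *\<^sub>R x))) {0..1}"
      by (rule fundamental_theorem_of_calculus)
        (auto simp: has_vector_derivative_def G_def lin algebra_simps
          intro!: derivative_eq_intros has_derivative_compose[OF _ a])
    from has_integral_linear[OF this bounded_linear_blinfun_inner_right]
    show ?thesis by (simp add: o_def integral_unique)
  qed
  ultimately show ?thesis
    by (intro exI[of _ u]) (simp add: u_def)
qed

section \<open>Hopf's boundary point lemma\<close>

lemma second_derivative_nonneg_at_local_min: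
  fixes f :: "'a::real_inner \<Rightarrow> real"
  assumes "open S" "x \<in> S"
    and f: "\<And>y. y \<in> S \<Longrightarrow> (f has_derivative (\<lambda>h. g y \<bullet> h)) (at y)"
    and g: "(g has_derivative G) (at x)"
    and le: "\<And>y. y \<in> S \<Longrightarrow> f x \<le> f y"
  shows "G h \<bullet> h \<ge> 0"
proof (rule ccontr)
  assume neg: "\<not> G h \<bullet> h \<ge> 0"
  define q where "q = (\<lambda>t. g (x + t *\<^sub>R h) \<bullet> h)"
  have "g x \<bullet> h = 0"
    using differential_zero_maxmin[OF \<open>x \<in> S\<close> \<open>open S\<close> f[OF \<open>x \<in> S\<close>]] le by (metis (no_types))
  then have q0: "q 0 = 0" by (simp add: q_def)
  have "(q has_real_derivative (G h \<bullet> h)) (at 0)"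
    unfolding q_def
    by (rule has_real_derivative_along_line) (simp add: has_derivative_inner_left[OF g])
  then obtain d where d: "d > 0" "\<And>t. 0 < t \<Longrightarrow> t < d \<Longrightarrow> q t < 0"
    using DERIV_neg_dec_right[of q "G h \<bullet> h" 0] neg q0 by auto
  have "eventually (\<lambda>t. x + t *\<^sub>R h \<in> S) (at_right (0::real))"
  proof -
    have "((\<lambda>t::real. x + t *\<^sub>R h) \<longlongrightarrow> x + 0 *\<^sub>R h) (at_right 0)"
      by (intro tendsto_intros)
    then show ?thesis using assms(1,2) topological_tendstoD by fastforce
  qed
  then obtain e where e: "e > 0" "\<And>t. 0 < t \<Longrightarrow> t < e \<Longrightarrow> x + t *\<^sub>R h \<in> S"
    unfolding eventually_at_right_field by auto
  define t where "t = min d e / 2"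
  have t: "0 < t" "t < d" "t < e" using d e by (auto simp: t_def)
  have inS: "x + s *\<^sub>R h \<in> S" if "0 \<le> s" "s \<le> t" for s
    using that t e \<open>x \<in> S\<close> by (cases "s = 0") auto
  have "((\<lambda>s. f (x + s *\<^sub>R h)) has_real_derivative q s) (at s)" if "0 \<le> s" "s \<le> t" for s
    unfolding q_def using that by (intro has_real_derivative_along_line f inS)
  then obtain s where s: "0 < s" "s < t" "f (x + t *\<^sub>R h) - f (x + 0 *\<^sub>R h) = (t - 0) * q s"
    using MVT2[of 0 t "\<lambda>s. f (x + s *\<^sub>R h)" q] t(1) by auto
  have "(t - 0) * q s < 0" using d(2)[of s] s t by (simp add: mult_pos_neg)
  then show False using s(3) le[OF inS[of t]] t by simp
qed

lemma trace_of_rank_one_update: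
  fixes z :: "'a::euclidean_space"
  shows "(\<Sum>b\<in>Basis. (c *\<^sub>R b + (d * (z \<bullet> b)) *\<^sub>R z) \<bullet> b) = c * DIM('a) + d * (z \<bullet> z)"
proof -
  have "(\<Sum>b\<in>Basis. (c *\<^sub>R b + (d * (z \<bullet> b)) *\<^sub>R z) \<bullet> b) = (\<Sum>b\<in>(Basis::'a set). c + d * ((z \<bullet> b) * (z \<bullet> b)))"
    by (intro sum.cong refl) (simp add: inner_add_left inner_Basis)
  then show ?thesis
    by (simp add: sum.distrib sum_distrib_left[symmetric] euclidean_inner[of z z])
qed

text \<open>Hopf's boundary point lemma on a ball, for \<open>w > 0\<close> with \<open>\<Delta>w \<le> C w\<close>. Here \<open>g\<close> is the gradient
  of \<open>w\<close> and the trace of \<open>G\<close> is its Laplacian. The barrier is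
  \<open>h(y) = exp(-\<alpha> |y - c|\<^sup>2) - exp(-\<alpha> r\<^sup>2)\<close>.\<close>
lemma hopf_lemma:
  fixes w :: "'a::euclidean_space \<Rightarrow> real" and C :: real
  assumes r: "r > 0" and q: "norm (q - c) = r" and C: "C \<ge> 0"
    and w: "\<And>y. y \<in> cball c r \<Longrightarrow> (w has_derivative (\<lambda>h. g y \<bullet> h)) (at y)"
    and g: "\<And>y. y \<in> ball c r \<Longrightarrow> (g has_derivative G y) (at y)"
    and lap: "\<And>y. y \<in> ball c r \<Longrightarrow> (\<Sum>b\<in>Basis. G y b \<bullet> b) \<le> C * w y"
    and pos: "\<And>y. y \<in> ball c r \<Longrightarrow> w y > 0" and wq: "w q = 0"
  shows "g q \<bullet> (c - q) > 0"
proof -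
  define n where "n = real DIM('a)"
  \<comment> \<open>Large enough to give \<open>\<Delta>h > C h\<close> on the outer half \<open>r/2 \<le> |y - c| \<le> r\<close> of the ball.\<close>
  define \<alpha> where "\<alpha> = (2 * n + 1) / r\<^sup>2 + C + 1"
  have n: "n > 0" by (simp add: n_def)
  have \<alpha>: "\<alpha> > C" "\<alpha> > 0" using n r C by (auto simp: \<alpha>_def add_pos_nonneg add_nonneg_pos)
  have \<alpha>r: "\<alpha> * r\<^sup>2 \<ge> 2 * n + 1"
    using r C by (simp add: \<alpha>_def field_simps)
  define h where "h = (\<lambda>y. exp (- \<alpha> * ((y - c) \<bullet> (y - c))) - exp (- \<alpha> * r\<^sup>2))"
  define h' where "h' = (\<lambda>y. (- 2 * \<alpha> * exp (- \<alpha> * ((y - c) \<bullet> (y - c)))) *\<^sub>R (y - c))"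
  define H where "H = (\<lambda>y k. (- 2 * \<alpha> * exp (- \<alpha> * ((y - c) \<bullet> (y - c)))) *\<^sub>R k
     + ((4 * \<alpha>\<^sup>2 * exp (- \<alpha> * ((y - c) \<bullet> (y - c)))) * ((y - c) \<bullet> k)) *\<^sub>R (y - c))"
  have h: "(h has_derivative (\<lambda>k. h' y \<bullet> k)) (at y)" for y
    unfolding h_def h'_def
    by (auto intro!: derivative_eq_intros simp: fun_eq_iff inner_commute algebra_simps)
  have h': "(h' has_derivative H y) (at y)" for y
    unfolding h'_def H_def
    by (auto intro!: derivative_eq_intros simp: fun_eq_iff inner_commute algebra_simps power2_eq_square
       scaleR_add_left[symmetric])
  have lap_h: "(\<Sum>b\<in>Basis. H y b \<bullet> b) > C * h y" if "r / 2 \<le> norm (y - c)" for y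
  proof -
    define s where "s = (y - c) \<bullet> (y - c)"
    have "(r / 2)\<^sup>2 \<le> (norm (y - c))\<^sup>2" using that r by (intro power_mono) auto
    then have s: "r\<^sup>2 \<le> 4 * s" by (simp add: s_def power2_norm_eq_inner power_divide)
    have "\<alpha> * (2 * n + 1) \<le> \<alpha> * (\<alpha> * r\<^sup>2)" using \<alpha>r \<alpha> by (intro mult_left_mono) auto
    also have "\<dots> \<le> \<alpha> * (\<alpha> * (4 * s))" using s \<alpha> by (intro mult_left_mono) auto
    finally have "C < - 2 * \<alpha> * n + 4 * \<alpha>\<^sup>2 * s" using \<alpha> by (simp add: algebra_simps power2_eq_square)
    then have "C * exp (- \<alpha> * s) < (- 2 * \<alpha> * n + 4 * \<alpha>\<^sup>2 * s) * exp (- \<alpha> * s)"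
      by (intro mult_strict_right_mono) auto
    moreover have "C * h y \<le> C * exp (- \<alpha> * s)"
      using C by (intro mult_left_mono) (auto simp: h_def s_def)
    moreover have "(\<Sum>b\<in>Basis. H y b \<bullet> b) = (- 2 * \<alpha> * n + 4 * \<alpha>\<^sup>2 * s) * exp (- \<alpha> * s)"
      unfolding H_def trace_of_rank_one_update s_def[symmetric] n_def[symmetric]
      by (simp add: algebra_simps)
    ultimately show ?thesis by linarith
  qed
  have cw: "continuous_on S w" if "S \<subseteq> cball c r" for S
    using that by (intro continuous_at_imp_continuous_on ballI has_derivative_continuous[OF w]) auto
  have ch: "continuous_on S h" for S
    unfolding h_def by (intro continuous_intros)
  have "sphere c (r / 2) \<noteq> {}" using r by simp
  then obtain m where m: "m \<in> sphere c (r / 2)" "\<And>y. y \<in> sphere c (r / 2) \<Longrightarrow> w m \<le> w y"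
    using continuous_attains_inf[OF compact_sphere \<open>sphere c (r / 2) \<noteq> {}\<close> cw] r
    by (auto simp: subset_iff)
  define e where "e = w m"
  have e: "e > 0" unfolding e_def using m r by (intro pos) auto
  define A where "A = cball c r - ball c (r / 2)"
  have "compact A" unfolding A_def by (intro compact_diff) auto
  \<comment> \<open>Comparison of \<open>w\<close> with the barrier \<open>e h\<close> on the annulus \<open>A\<close>.\<close>
  have compare: "w y \<ge> e * h y" if yA: "y \<in> A" for y
  proof (rule ccontr)
    assume less: "\<not> w y \<ge> e * h y"
    have "continuous_on A (\<lambda>y. w y - e * h y)"
      using cw[of A] ch[of A] by (intro continuous_intros) (auto simp: A_def)
    then obtain z where z: "z \<in> A" "\<And>y. y \<in> A \<Longrightarrow> w z - e * h z \<le> w y - e * h y"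
      using continuous_attains_inf[OF \<open>compact A\<close>, of "\<lambda>y. w y - e * h y"] yA by blast
    have neg: "w z < e * h z" using z(2)[OF yA] less by linarith
    have hle: "h z \<le> 1"
    proof -
      have "exp (- \<alpha> * ((z - c) \<bullet> (z - c))) \<le> 1" using \<alpha> by (simp add: zero_le_mult_iff)
      then show ?thesis unfolding h_def using exp_gt_zero[of "- \<alpha> * r\<^sup>2"] by linarith
    qed
    have "dist c z \<noteq> r / 2"
    proof
      assume "dist c z = r / 2"
      then have "e \<le> w z" unfolding e_def by (intro m) auto
      moreover have "e * h z \<le> e" using e hle by (simp add: mult_left_le)
      ultimately show False using neg by linarith
    qed
    moreover have "dist c z \<noteq> r"
    proof
      assume d: "dist c z = r"
      have "(z - c) \<bullet> (z - c) = r\<^sup>2" using d by (simp add: dist_norm norm_minus_commute flip: power2_norm_eq_inner)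
      then have "h z = 0" by (simp add: h_def)
      moreover have "w z \<ge> 0"
      proof -
        have "z \<in> closure (ball c r)" using d r by simp
        then show ?thesis
          using continuous_ge_on_closure[of "ball c r" w z 0] cw pos r by (simp add: less_imp_le)
      qed
      ultimately show False using neg by simp
    qed
    ultimately have zin: "z \<in> ball c r - cball c (r / 2)" using z(1) by (auto simp: A_def)
    define S where "S = ball c r - cball c (r / 2)"
    have "(G z k - e *\<^sub>R H z k) \<bullet> k \<ge> 0" for k
    proof (rule second_derivative_nonneg_at_local_min[where S = S and x = z and f = "\<lambda>y. w y - e * h y" and g = "\<lambda>y. g y - e *\<^sub>R h' y" and h = k])
      show "open S" "z \<in> S" using zin by (auto simp: S_def)
      show "((\<lambda>y. w y - e * h y) has_derivative (\<lambda>k. (g y - e *\<^sub>R h' y) \<bullet> k)) (at y)" if "y \<in> S" for y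
        using that by (auto intro!: derivative_eq_intros w h simp: S_def inner_diff_left)
      show "((\<lambda>y. g y - e *\<^sub>R h' y) has_derivative (\<lambda>k. G z k - e *\<^sub>R H z k)) (at z)"
        using zin by (auto intro!: derivative_eq_intros g h')
      show "w z - e * h z \<le> w y - e * h y" if "y \<in> S" for y
        using that by (intro z) (auto simp: S_def A_def)
    qed
    then have "0 \<le> (\<Sum>b\<in>Basis. (G z b - e *\<^sub>R H z b) \<bullet> b)" by (intro sum_nonneg) auto
    also have "\<dots> = (\<Sum>b\<in>Basis. G z b \<bullet> b) - e * (\<Sum>b\<in>Basis. H z b \<bullet> b)"
      by (simp add: inner_diff_left sum_subtractf sum_distrib_left)
    also have "\<dots> < C * w z - e * (C * h z)"
      using lap[of z] zin mult_strict_left_mono[OF lap_h[of z] e]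
      by (auto simp: dist_norm norm_minus_commute)
    also have "\<dots> = C * (w z - e * h z)" by (simp add: algebra_simps)
    also have "\<dots> \<le> 0" using neg C by (simp add: mult_nonneg_nonpos)
    finally show False by simp
  qed
  \<comment> \<open>On the segment from \<open>q\<close> to \<open>c\<close> the function \<open>w - e h\<close> starts at 0 and stays nonnegative.\<close>
  define \<psi> where "\<psi> = (\<lambda>t. w (q + t *\<^sub>R (c - q)) - e * h (q + t *\<^sub>R (c - q)))"
  have hq: "h q = 0" using q by (simp add: h_def flip: power2_norm_eq_inner)
  have "(\<psi> has_real_derivative (g q \<bullet> (c - q) - e * (h' q \<bullet> (c - q)))) (at 0)"
  proof -
    have "((\<lambda>y. w y - e * h y) has_derivative (\<lambda>k. g q \<bullet> k - e * (h' q \<bullet> k))) (at (q + 0 *\<^sub>R (c - q)))"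
      using q by (auto intro!: derivative_eq_intros w h simp: dist_norm norm_minus_commute)
    from has_real_derivative_along_line[OF this] show ?thesis
      by (simp add: \<psi>_def)
  qed
  moreover have "\<psi> 0 = 0" by (simp add: \<psi>_def wq hq)
  moreover have "\<psi> t \<ge> 0" if "0 < t" "t < 1 / 2" for t
  proof -
    have "q + t *\<^sub>R (c - q) - c = (1 - t) *\<^sub>R (q - c)" by (simp add: algebra_simps)
    then have "norm (q + t *\<^sub>R (c - q) - c) = (1 - t) * r" using that q by simp
    moreover have "(1 - t) * r \<le> 1 * r" "(1/2) * r \<le> (1 - t) * r" using that r by (auto intro!: mult_right_mono)
    ultimately have "q + t *\<^sub>R (c - q) \<in> A"
      by (auto simp: A_def dist_norm norm_minus_commute[of c])
    then show ?thesis using compare by (simp add: \<psi>_def)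
  qed
  ultimately have "g q \<bullet> (c - q) - e * (h' q \<bullet> (c - q)) \<ge> 0"
    using DERIV_neg_dec_right[of \<psi> "g q \<bullet> (c - q) - e * (h' q \<bullet> (c - q))" 0]
    by (smt (verit) field_sum_of_halves zero_less_divide_1_iff add_0)
  moreover have "e * (h' q \<bullet> (c - q)) > 0"
  proof -
    have "(q - c) \<bullet> (q - c) = r\<^sup>2" using q by (simp flip: power2_norm_eq_inner)
    moreover have "(q - c) \<bullet> (c - q) = - ((q - c) \<bullet> (q - c))" by (simp add: algebra_simps)
    ultimately show ?thesis using e \<alpha> r by (simp add: h'_def)
  qed
  ultimately show ?thesis by linarith
qed

section \<open>The method of moving planes\<close>

text \<open>The reflection in the hyperplane \<open>x \<bullet> e = l\<close>, for a unit vector \<open>e\<close>. With \<open>l = 0\<close> it is also the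
  linear part of all the reflections with normal \<open>e\<close>.\<close>
definition reflection :: "'a::real_inner \<Rightarrow> real \<Rightarrow> 'a \<Rightarrow> 'a" where
  "reflection e l x = x - (2 * (x \<bullet> e - l)) *\<^sub>R e"

lemma reflection_fixes_hyperplane: "x \<bullet> e = l \<Longrightarrow> reflection e l x = x"
  by (simp add: reflection_def)

lemma norm_reflection_sq:
  assumes "norm e = 1"
  shows "(norm (reflection e l x))\<^sup>2 = (norm x)\<^sup>2 - 4 * l * (x \<bullet> e - l)"
proof -
  have "e \<bullet> e = 1" using assms by (simp add: norm_eq_1)
  then show ?thesis
    unfolding power2_norm_eq_inner reflection_def
    by (simp add: inner_diff_left inner_diff_right inner_commute[of e x] power2_eq_square algebra_simps)
qed

lemma continuous_on_reflection [continuous_intros]: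
  assumes "continuous_on S f" "continuous_on S g"
  shows "continuous_on S (\<lambda>z. reflection e (f z) (g z))"
  unfolding reflection_def by (intro continuous_intros assms)

lemma tendsto_reflection [tendsto_intros]:
  assumes "(f \<longlongrightarrow> l) F" "(g \<longlongrightarrow> x) F"
  shows "((\<lambda>z. reflection e (f z) (g z)) \<longlongrightarrow> reflection e l x) F"
  unfolding reflection_def by (intro tendsto_intros assms)

lemma has_derivative_reflection:
  "(reflection e l has_derivative reflection e 0) (at x)"
  unfolding reflection_def[abs_def] by (auto intro!: derivative_eq_intros)

text \<open>The Laplacian is invariant under reflections.\<close>
lemma trace_reflection_conjugate:
  fixes A :: "'a::euclidean_space \<Rightarrow> 'a"
  assumes "linear A" "norm e = 1"
  shows "(\<Sum>b\<in>Basis. reflection e 0 (A (reflection e 0 b)) \<bullet> b) = (\<Sum>b\<in>Basis. A b \<bullet> b)"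
proof -
  have ee: "e \<bullet> e = 1" using assms by (simp add: norm_eq_1)
  have rep: "(\<Sum>b\<in>Basis. (b \<bullet> e) *\<^sub>R b) = e"
    using euclidean_representation[of e] by (simp add: inner_commute)
  have 1: "(\<Sum>b\<in>Basis. (b \<bullet> e) * (A e \<bullet> b)) = A e \<bullet> e"
    using euclidean_inner[of "A e" e] by (simp add: inner_commute mult.commute)
  have 2: "(\<Sum>b\<in>Basis. (b \<bullet> e) * (A b \<bullet> e)) = A e \<bullet> e"
  proof -
    have "A e = (\<Sum>b\<in>Basis. (b \<bullet> e) *\<^sub>R A b)"
      by (subst rep[symmetric]) (simp add: linear_sum[OF assms(1)] linear_scale[OF assms(1)])
    then show ?thesis by (metis (no_types, lifting) inner_scaleR_left inner_sum_left sum.cong)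
  qed
  have 3: "(\<Sum>b\<in>Basis. (b \<bullet> e) * (b \<bullet> e)) = 1"
    using euclidean_inner[of e e] ee by (simp add: inner_commute)
  have "reflection e 0 (A (reflection e 0 b)) \<bullet> b
      = A b \<bullet> b - 2 * ((b \<bullet> e) * (A e \<bullet> b)) - 2 * ((b \<bullet> e) * (A b \<bullet> e))
        + 4 * (A e \<bullet> e) * ((b \<bullet> e) * (b \<bullet> e))" for b
    unfolding reflection_def
    by (simp add: linear_diff[OF assms(1)] linear_scale[OF assms(1)] inner_diff_left inner_commute[of e b] algebra_simps)
  then show ?thesis
    by (simp add: sum.distrib sum_subtractf sum_distrib_left[symmetric] 1 2 3)
qed

text \<open>The setting of the moving plane argument: \<open>a\<close> and \<open>A\<close> are the gradient and the Hessian of \<open>u\<close>.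
  The equation \<open>\<Delta>u = f(u)\<close>, with \<open>f\<close> locally Lipschitz on the positive reals, enters only through
  the Lipschitz bound below, stated without naming \<open>f\<close>; no regularity of \<open>f\<close> at \<open>0\<close> is required.
  In place of that, the last assumption says that the comparison of \<open>u\<close> with its reflection is
  already known near the sphere of radius \<open>R\<close> and near infinity, uniformly for the hyperplanes at
  distance at least \<open>m\<close> from the origin.\<close>
locale moving_plane =
  fixes u :: "'a::euclidean_space \<Rightarrow> real" and a :: "'a \<Rightarrow> 'a" and A :: "'a \<Rightarrow> 'a \<Rightarrow> 'a"
    and R :: real
  assumes grad: "(u has_derivative (\<lambda>h. a x \<bullet> h)) (at x)"
    and hess: "(a has_derivative A x) (at x)"
    and R_pos: "R > 0"
    and u_inside: "norm x \<le> R \<Longrightarrow> u x = 0"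
    and u_outside: "norm x > R \<Longrightarrow> u x > 0"
    and laplacian_Lipschitz: "t > 0 \<Longrightarrow> \<exists>d>0. \<exists>L. \<forall>x y. \<bar>u x - t\<bar> < d \<longrightarrow> \<bar>u y - t\<bar> < d \<longrightarrow>
       \<bar>(\<Sum>b\<in>Basis. A x b \<bullet> b) - (\<Sum>b\<in>Basis. A y b \<bullet> b)\<bar> \<le> L * \<bar>u x - u y\<bar>"
    and ends: "norm e = 1 \<Longrightarrow> m > 0 \<Longrightarrow> \<exists>d>0. \<exists>M. \<forall>l\<ge>m. \<forall>x. x \<bullet> e > l \<longrightarrow>
       (R < norm x \<and> norm x < R + d) \<or> norm x > M \<longrightarrow> u (reflection e l x) < u x"
begin

lemma tendsto_u: "(f \<longlongrightarrow> x) F \<Longrightarrow> ((\<lambda>z. u (f z)) \<longlongrightarrow> u x) F"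
  using has_derivative_continuous[OF grad] isCont_tendsto_compose by blast

lemma tendsto_a: "(f \<longlongrightarrow> x) F \<Longrightarrow> ((\<lambda>z. a (f z)) \<longlongrightarrow> a x) F"
  using has_derivative_continuous[OF hess] isCont_tendsto_compose by blast

lemma difference_has_derivative:
  "((\<lambda>y. u y - u (reflection e l y)) has_derivative
     (\<lambda>h. (a x - reflection e 0 (a (reflection e l x))) \<bullet> h)) (at x)"
  by (rule has_derivative_eq_rhs[OF has_derivative_diff[OF grad
        has_derivative_compose[OF has_derivative_reflection grad]]])
    (simp add: fun_eq_iff reflection_def inner_diff_left inner_diff_right inner_commute)

lemma difference_gradient_has_derivative:
  "((\<lambda>y. a y - reflection e 0 (a (reflection e l y))) has_derivative
     (\<lambda>h. A x h - reflection e 0 (A (reflection e l x) (reflection e 0 h)))) (at x)"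
  by (rule has_derivative_diff[OF hess has_derivative_compose[OF
        has_derivative_compose[OF has_derivative_reflection hess] has_derivative_reflection]])

text \<open>Hopf's lemma for \<open>w(y) = u(y) - u(y')\<close>, where \<open>y'\<close> is the reflection of \<open>y\<close>: if \<open>w\<close> is positive in
  a ball and vanishes at a boundary point \<open>q\<close>, then its inner normal derivative at \<open>q\<close> is positive.\<close>
lemma tangent_ball:
  assumes e: "norm e = 1" and r: "r > 0" "norm (q - c) = r" and q: "norm q > R"
    and eq: "u (reflection e l q) = u q"
    and less: "\<And>y. y \<in> ball c r \<Longrightarrow> u (reflection e l y) < u y"
  shows "(a q - reflection e 0 (a (reflection e l q))) \<bullet> (c - q) > 0"
proof -
  obtain d L where d: "d > 0" and L: "\<And>x y. \<bar>u x - u q\<bar> < d \<Longrightarrow> \<bar>u y - u q\<bar> < d \<Longrightarrow>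
       \<bar>(\<Sum>b\<in>Basis. A x b \<bullet> b) - (\<Sum>b\<in>Basis. A y b \<bullet> b)\<bar> \<le> L * \<bar>u x - u y\<bar>"
    using laplacian_Lipschitz[OF u_outside[OF q]] by blast
  have "((\<lambda>y. u (reflection e l y)) \<longlongrightarrow> u q) (nhds q)" "(u \<longlongrightarrow> u q) (nhds q)"
    using tendsto_u[OF tendsto_reflection[OF tendsto_const, of "\<lambda>x. x" q "nhds q" e l]] eq
      tendsto_u[of "\<lambda>x. x" q "nhds q"] by (auto simp: filterlim_ident)
  then have "eventually (\<lambda>y. dist (u (reflection e l y)) (u q) < d \<and> dist (u y) (u q) < d) (nhds q)"
    using d by (intro eventually_conj tendstoD)
  then obtain k where k: "k > 0" "\<And>y. dist y q < k \<Longrightarrow> \<bar>u (reflection e l y) - u q\<bar> < d \<and> \<bar>u y - u q\<bar> < d"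
    unfolding eventually_nhds_metric dist_real_def by blast
  \<comment> \<open>A smaller ball, internally tangent at \<open>q\<close>, on which the Lipschitz bound at the level \<open>u q\<close>
    is available.\<close>
  define s where "s = min 1 (k / (2 * r))"
  have s: "0 < s" "s \<le> 1" "s * (2 * r) \<le> k" using k r by (auto simp: s_def min_def field_simps)
  define c' where "c' = q + s *\<^sub>R (c - q)"
  have "q - c' = s *\<^sub>R (q - c)" by (simp add: c'_def algebra_simps)
  then have qc': "norm (q - c') = s * r" using r s by simp
  have "c' - c = (1 - s) *\<^sub>R (q - c)" by (simp add: c'_def algebra_simps)
  then have cc': "norm (c' - c) = (1 - s) * r" using r s by simp
  have sub: "y \<in> ball c r" "dist y q < k" if "y \<in> ball c' (s * r)" for y
  proof -
    have y: "norm (y - c') < s * r" using that by (simp add: dist_norm norm_minus_commute)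
    have "norm (y - c) \<le> norm (y - c') + norm (c' - c)"
      using norm_triangle_ineq[of "y - c'" "c' - c"] by simp
    also have "\<dots> < r" using y cc' by (simp add: algebra_simps)
    finally show "y \<in> ball c r" by (simp add: dist_norm norm_minus_commute)
    have "norm (y - q) \<le> norm (y - c') + norm (q - c')"
      using norm_triangle_ineq4[of "y - c'" "q - c'"] by simp
    also have "\<dots> < s * (2 * r)" using y qc' by (simp add: mult.commute)
    finally show "dist y q < k" using s by (simp add: dist_norm)
  qed
  have "(a q - reflection e 0 (a (reflection e l q))) \<bullet> (c' - q) > 0"
  proof (rule hopf_lemma[where w = "\<lambda>y. u y - u (reflection e l y)" and C = "\<bar>L\<bar>"
        and g = "\<lambda>y. a y - reflection e 0 (a (reflection e l y))"
        and G = "\<lambda>x h. A x h - reflection e 0 (A (reflection e l x) (reflection e 0 h))"])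
    show "0 < s * r" "norm (q - c') = s * r" "0 \<le> \<bar>L\<bar>" using r s qc' by auto
    show "u q - u (reflection e l q) = 0" using eq by simp
    fix y assume y: "y \<in> ball c' (s * r)"
    show "u y - u (reflection e l y) > 0" using less[OF sub(1)[OF y]] by simp
    have "(\<Sum>b\<in>Basis. (A y b - reflection e 0 (A (reflection e l y) (reflection e 0 b))) \<bullet> b)
       = (\<Sum>b\<in>Basis. A y b \<bullet> b) - (\<Sum>b\<in>Basis. A (reflection e l y) b \<bullet> b)"
      by (simp add: inner_diff_left sum_subtractf trace_reflection_conjugate[OF has_derivative_linear[OF hess] e])
    also have "\<dots> \<le> L * \<bar>u y - u (reflection e l y)\<bar>"
      using L[of y "reflection e l y"] k(2)[OF sub(2)[OF y]] by linarith
    also have "\<dots> \<le> \<bar>L\<bar> * (u y - u (reflection e l y))"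
      using less[OF sub(1)[OF y]] by (auto intro!: mult_right_mono)
    finally show "(\<Sum>b\<in>Basis. (A y b - reflection e 0 (A (reflection e l y) (reflection e 0 b))) \<bullet> b)
        \<le> \<bar>L\<bar> * (u y - u (reflection e l y))" .
  qed (intro difference_has_derivative difference_gradient_has_derivative)+
  then show ?thesis using s by (simp add: c'_def zero_less_mult_iff)
qed

text \<open>The strong maximum principle for the difference with the reflection. Connectedness of the
  half-space minus the ball is not needed: if the difference had a zero, its last zero on a ray in
  direction \<open>e\<close> would have points where the difference is positive arbitrarily close to it.\<close>
lemma strict_of_weak:
  assumes e: "norm e = 1" and l: "l > 0"
    and weak: "\<And>x. x \<bullet> e > l \<Longrightarrow> norm x > R \<Longrightarrow> u (reflection e l x) \<le> u x"
    and far: "\<And>x. x \<bullet> e > l \<Longrightarrow> norm x > M \<Longrightarrow> u (reflection e l x) < u x"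
    and x: "x \<bullet> e > l" "norm x > R"
  shows "u (reflection e l x) < u x"
proof (rule ccontr)
  assume "\<not> u (reflection e l x) < u x"
  then have x0: "u (reflection e l x) = u x" using weak[OF x] by simp
  have ee: "e \<bullet> e = 1" using e by (simp add: norm_eq_1)
  define D where "D = {x. x \<bullet> e > l \<and> norm x > R}"
  have "open D" unfolding D_def by (intro open_Collect_conj open_Collect_less continuous_intros)
  have ray: "x + t *\<^sub>R e \<in> D \<and> norm (x + t *\<^sub>R e) \<ge> t" if "t \<ge> 0" for t
  proof -
    have pos: "(x + t *\<^sub>R e) \<bullet> e > l" "(x + t *\<^sub>R e) \<bullet> e \<ge> t" using x that ee l by (auto simp: inner_add_left)
    have "(norm x)\<^sup>2 \<le> (norm (x + t *\<^sub>R e))\<^sup>2"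
      unfolding power2_norm_eq_inner using x l that ee
      by (simp add: inner_add_left inner_add_right inner_commute[of e x])
    then have "norm x \<le> norm (x + t *\<^sub>R e)" using power2_le_imp_le norm_ge_zero by blast
    then show ?thesis using pos x norm_cauchy_schwarz[of "x + t *\<^sub>R e" e] e by (auto simp: D_def)
  qed
  define T where "T = {t. 0 \<le> t \<and> u (x + t *\<^sub>R e) - u (reflection e l (x + t *\<^sub>R e)) = 0}"
  have cw: "continuous_on S (\<lambda>y. u (f y) - u (reflection e l (f y)))" if "continuous_on S f" for S and f :: "'z::topological_space \<Rightarrow> 'a"
    by (intro continuous_intros continuous_on_compose2[OF continuous_on_if_has_derivative[OF grad, of UNIV]] that) auto
  have "closed T" unfolding T_def
    by (intro closed_Collect_conj closed_Collect_le closed_Collect_eq cw continuous_intros)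
  moreover have "T \<subseteq> {0..max M 0}"
  proof
    fix t assume t: "t \<in> T"
    then have t0: "t \<ge> 0" "u (reflection e l (x + t *\<^sub>R e)) = u (x + t *\<^sub>R e)" by (auto simp: T_def)
    have "\<not> norm (x + t *\<^sub>R e) > M" using far[of "x + t *\<^sub>R e"] ray[OF t0(1)] t0(2) by (auto simp: D_def)
    then show "t \<in> {0..max M 0}" using ray[OF t0(1)] t0 by auto
  qed
  ultimately have "compact T"
    using bounded_closed_interval bounded_subset compact_eq_bounded_closed by (metis compact_Icc)
  moreover have "0 \<in> T" using x0 by (simp add: T_def)
  ultimately obtain t where t: "t \<in> T" "\<And>s. s \<in> T \<Longrightarrow> s \<le> t"
    using compact_attains_sup[of T] by blast
  define p where "p = x + t *\<^sub>R e"
  have "p \<in> D" using ray t by (auto simp: T_def p_def)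
  then obtain \<rho> where \<rho>: "\<rho> > 0" "ball p \<rho> \<subseteq> D" using \<open>open D\<close> open_contains_ball by blast
  \<comment> \<open>The largest zero-free ball around \<open>c\<close> stays in \<open>D\<close> and touches the zero set at \<open>q\<close>.\<close>
  define c where "c = p + (\<rho> / 3) *\<^sub>R e"
  have pc: "dist p c = \<rho> / 3" using \<rho> e by (simp add: c_def dist_norm)
  define Z where "Z = {z. u z - u (reflection e l z) = 0}"
  have "closed Z" unfolding Z_def by (intro closed_Collect_eq cw continuous_intros)
  have "p \<in> Z" using t by (auto simp: T_def p_def Z_def)
  then obtain q where q: "q \<in> Z" "\<And>y. y \<in> Z \<Longrightarrow> dist c q \<le> dist c y"
    using distance_attains_inf[OF \<open>closed Z\<close>] by blast
  have "c \<notin> Z"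
  proof
    assume "c \<in> Z"
    then have "t + \<rho> / 3 \<in> T" using t \<rho> by (auto simp: Z_def T_def c_def p_def algebra_simps)
    then show False using t(2)[of "t + \<rho> / 3"] \<rho> by simp
  qed
  then have r: "dist c q > 0" using q by auto
  have rle: "dist c q \<le> \<rho> / 3" using q(2)[OF \<open>p \<in> Z\<close>] pc by (simp add: dist_commute)
  have sub: "y \<in> D" if "dist c y \<le> \<rho> / 3" for y
    using that \<rho> pc dist_triangle[of p y c] by (intro subsetD[OF \<rho>(2)]) simp
  have "q \<in> D" using sub rle by simp
  have "(a q - reflection e 0 (a (reflection e l q))) \<bullet> (c - q) > 0"
  proof (rule tangent_ball[OF e r])
    show "norm (q - c) = dist c q" by (simp add: dist_norm norm_minus_commute)
    show "R < norm q" using \<open>q \<in> D\<close> by (simp add: D_def)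
    show "u (reflection e l q) = u q" using q by (simp add: Z_def)
    show "u (reflection e l y) < u y" if "y \<in> ball c (dist c q)" for y
    proof -
      have "y \<in> D" using that rle by (intro sub) simp
      then have "u (reflection e l y) \<le> u y" by (intro weak) (auto simp: D_def)
      moreover have "y \<notin> Z" using q(2)[of y] that by auto
      ultimately show ?thesis by (auto simp: Z_def)
    qed
  qed
  moreover have "(\<lambda>h. (a q - reflection e 0 (a (reflection e l q))) \<bullet> h) = (\<lambda>h. 0)"
    using q(1) weak
    by (intro differential_zero_maxmin[OF \<open>q \<in> D\<close> \<open>open D\<close> difference_has_derivative]) (auto simp: Z_def D_def)
  ultimately show False by (metis less_irrefl)
qed

lemma normal_derivative_pos:
  assumes e: "norm e = 1"
    and strict: "\<And>x. x \<bullet> e > l \<Longrightarrow> norm x > R \<Longrightarrow> u (reflection e l x) < u x"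
    and x: "x \<bullet> e = l" "norm x > R"
  shows "a x \<bullet> e > 0"
proof -
  have ee: "e \<bullet> e = 1" using e by (simp add: norm_eq_1)
  define r where "r = (norm x - R) / 3"
  have r: "r > 0" using x by (simp add: r_def)
  define c where "c = x + r *\<^sub>R e"
  have "(a x - reflection e 0 (a (reflection e l x))) \<bullet> (c - x) > 0"
  proof (rule tangent_ball[OF e r _ x(2)])
    show "norm (x - c) = r" using r e by (simp add: c_def)
    show "u (reflection e l x) = u x" using x by (simp add: reflection_fixes_hyperplane)
    show "u (reflection e l y) < u y" if "y \<in> ball c r" for y
    proof (rule strict)
      have y: "norm (y - c) < r" using that by (simp add: dist_norm norm_minus_commute)
      have "\<bar>(y - c) \<bullet> e\<bar> < r" using Cauchy_Schwarz_ineq2[of "y - c" e] y e by simp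
      then show "l < y \<bullet> e" using x ee by (simp add: c_def algebra_simps inner_add_left)
      have "norm x - norm y \<le> norm (y - x)" using norm_triangle_ineq3[of y x] by simp
      also have "\<dots> \<le> norm (y - c) + norm (r *\<^sub>R e)"
        using norm_triangle_ineq[of "y - c" "r *\<^sub>R e"] by (simp add: c_def)
      also have "\<dots> = norm (y - c) + r" using r e by simp
      also have "\<dots> < 3 * r" using y r by simp
      also have "\<dots> = norm x - R" by (simp add: r_def)
      finally show "R < norm y" by simp
    qed
  qed
  moreover have "(a x - reflection e 0 (a (reflection e l x))) \<bullet> (c - x) = r * (2 * (a x \<bullet> e))"
    using x ee by (simp add: reflection_fixes_hyperplane c_def reflection_def)
  ultimately show ?thesis using r by (simp add: zero_less_mult_iff)
qed

text \<open>The plane is moved inwards from infinity. If the comparison failed for some position, then at the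
  supremum \<open>k\<close> of the bad positions it would still hold in the weak sense, hence in the strict
  sense. Violations at bad positions tending to \<open>k\<close> stay in a compact set because of the
  assumption on the ends, and a limit point \<open>z\<close> of them contradicts the strict comparison if it
  lies off the hyperplane, and the sign of the normal derivative if it lies on it.\<close>
theorem reflection_decreases:
  assumes e: "norm e = 1" and l: "l > 0" and x: "x \<bullet> e > l" "norm x > R"
  shows "u (reflection e l x) < u x"
proof (rule ccontr)
  assume not_less: "\<not> u (reflection e l x) < u x"
  obtain d M where d: "d > 0" and ends': "\<And>m x. m \<ge> l \<Longrightarrow> x \<bullet> e > m \<Longrightarrow>
       (R < norm x \<and> norm x < R + d) \<or> norm x > M \<Longrightarrow> u (reflection e m x) < u x"
    using ends[OF e l] by metis
  define bad where "bad = (\<lambda>m x. x \<bullet> e > m \<and> norm x > R \<and> u x \<le> u (reflection e m x))"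
  have bad_bounds: "R + d \<le> norm x" "norm x \<le> M" if "bad m x" "m \<ge> l" for m x
    using ends'[of m x] that by (force simp: bad_def)+
  define S where "S = {m. m \<ge> l \<and> (\<exists>x. bad m x)}"
  have "l \<in> S" using not_less x by (auto simp: S_def bad_def)
  have S_le: "m \<le> M" if mS: "m \<in> S" for m
  proof -
    obtain x where "bad m x" "m \<ge> l" using mS by (auto simp: S_def)
    then have "m < x \<bullet> e" "norm x \<le> M" using bad_bounds by (auto simp: bad_def)
    then show ?thesis using norm_cauchy_schwarz[of x e] e by simp
  qed
  then have "bdd_above S" by (rule bdd_aboveI)
  define k where "k = Sup S"
  have k: "k \<ge> l" "k > 0" using cSup_upper[OF \<open>l \<in> S\<close> \<open>bdd_above S\<close>] l by (auto simp: k_def)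
  have "k \<in> closure S" unfolding k_def using \<open>l \<in> S\<close> \<open>bdd_above S\<close> by (intro closure_contains_Sup) auto
  then obtain ms where ms: "\<And>n. ms n \<in> S" "ms \<longlonglongrightarrow> k" unfolding closure_sequential by blast
  have "\<forall>n. \<exists>x. bad (ms n) x" using ms by (auto simp: S_def)
  then obtain xs where xs: "\<And>n. bad (ms n) (xs n)" by metis
  have msl: "ms n \<ge> l" for n using ms(1)[of n] by (simp add: S_def)
  have "compact (cball (0::'a) M)" by simp
  moreover have "\<forall>n. xs n \<in> cball 0 M" using bad_bounds(2)[OF xs msl] by simp
  ultimately obtain z and r :: "nat \<Rightarrow> nat" where z: "strict_mono r" "(xs \<circ> r) \<longlonglongrightarrow> z"
    unfolding compact_def by metis
  have xr: "(\<lambda>n. xs (r n)) \<longlonglongrightarrow> z" using z by (simp add: o_def)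
  have mr: "(\<lambda>n. ms (r n)) \<longlonglongrightarrow> k" using LIMSEQ_subseq_LIMSEQ[OF ms(2) z(1)] by (simp add: o_def)
  have "R + d \<le> norm z"
    by (rule tendsto_lowerbound[OF tendsto_norm[OF xr]]) (use bad_bounds(1)[OF xs msl] in auto)
  then have zR: "norm z > R" using d by simp
  have xrb: "ms (r n) < xs (r n) \<bullet> e" "u (xs (r n)) \<le> u (reflection e (ms (r n)) (xs (r n)))" for n
    using xs[of "r n"] by (auto simp: bad_def)
  have lim_inner: "(\<lambda>n. xs (r n) \<bullet> e) \<longlonglongrightarrow> z \<bullet> e" by (intro tendsto_intros xr)
  have zk: "k \<le> z \<bullet> e"
    by (rule LIMSEQ_le[OF mr lim_inner]) (use xrb(1) less_imp_le in blast)
  have zu: "u z \<le> u (reflection e k z)"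
    by (rule LIMSEQ_le[OF tendsto_u[OF xr] tendsto_u[OF tendsto_reflection[OF mr xr]]]) (use xrb(2) in blast)
  have weak: "u (reflection e k y) \<le> u y" if y: "y \<bullet> e > k" "norm y > R" for y
  proof -
    have "((\<lambda>m. u (reflection e m y)) \<longlongrightarrow> u (reflection e k y)) (at_right k)"
      by (intro tendsto_u tendsto_intros)
    moreover have "eventually (\<lambda>m. u (reflection e m y) \<le> u y) (at_right k)"
    proof -
      have "u (reflection e m y) \<le> u y" if m: "k < m" "m < y \<bullet> e" for m
      proof -
        have "m \<notin> S" using cSup_upper[OF _ \<open>bdd_above S\<close>, of m] m by (auto simp: k_def)
        then show ?thesis using m k y by (auto simp: S_def bad_def)
      qed
      then show ?thesis unfolding eventually_at_right_field using y(1) by blast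
    qed
    ultimately show ?thesis by (intro tendsto_upperbound) auto
  qed
  have strict: "u (reflection e k y) < u y" if "y \<bullet> e > k" "norm y > R" for y
    by (rule strict_of_weak[OF e k(2) weak _ that]) (use ends'[of k] k in auto)
  show False
  proof (cases "z \<bullet> e = k")
    case False
    then show False using strict[of z] zk zR zu by simp
  next
    case True
    have "\<forall>n. \<exists>s. 0 \<le> s \<and> s \<le> 2 * (xs (r n) \<bullet> e - ms (r n)) \<and> a (xs (r n) - s *\<^sub>R e) \<bullet> e \<le> 0"
    proof
      fix n
      define t where "t = 2 * (xs (r n) \<bullet> e - ms (r n))"
      have t: "t > 0" using xrb(1)[of n] by (simp add: t_def)
      define y where "y = reflection e (ms (r n)) (xs (r n))"
      have y: "y = xs (r n) - t *\<^sub>R e" by (simp add: y_def reflection_def t_def)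
      have "((\<lambda>s. u (y + s *\<^sub>R e)) has_real_derivative a (y + s *\<^sub>R e) \<bullet> e) (at s)" for s
        by (rule has_real_derivative_along_line[OF grad])
      then obtain s where s: "0 < s" "s < t" "u (y + t *\<^sub>R e) - u (y + 0 *\<^sub>R e) = (t - 0) * (a (y + s *\<^sub>R e) \<bullet> e)"
        using MVT2[OF t, of "\<lambda>s. u (y + s *\<^sub>R e)" "\<lambda>s. a (y + s *\<^sub>R e) \<bullet> e"] by blast
      have "t * (a (y + s *\<^sub>R e) \<bullet> e) \<le> 0" using s(3) xrb(2)[of n] by (simp add: y flip: y_def)
      then have "a (y + s *\<^sub>R e) \<bullet> e \<le> 0" using t by (simp add: mult_le_0_iff)
      then show "\<exists>s. 0 \<le> s \<and> s \<le> 2 * (xs (r n) \<bullet> e - ms (r n)) \<and> a (xs (r n) - s *\<^sub>R e) \<bullet> e \<le> 0"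
        using s by (intro exI[of _ "t - s"]) (auto simp: y t_def algebra_simps)
    qed
    then obtain s where s: "\<And>n. 0 \<le> s n" "\<And>n. s n \<le> 2 * (xs (r n) \<bullet> e - ms (r n))"
      "\<And>n. a (xs (r n) - s n *\<^sub>R e) \<bullet> e \<le> 0" by metis
    have "(\<lambda>n. 2 * (xs (r n) \<bullet> e - ms (r n))) \<longlonglongrightarrow> 2 * (z \<bullet> e - k)"
      by (intro tendsto_intros lim_inner mr)
    then have "s \<longlonglongrightarrow> 0"
      using True s by (intro real_tendsto_sandwich[where f = "\<lambda>_. 0" and g = s]) (auto intro!: always_eventually)
    then have "(\<lambda>n. xs (r n) - s n *\<^sub>R e) \<longlonglongrightarrow> z - 0 *\<^sub>R e" by (intro tendsto_intros xr)
    then have "(\<lambda>n. a (xs (r n) - s n *\<^sub>R e) \<bullet> e) \<longlonglongrightarrow> a z \<bullet> e"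
      by (intro tendsto_intros tendsto_a) simp
    then have "a z \<bullet> e \<le> 0" by (rule LIMSEQ_le_const2) (use s in blast)
    then show False using normal_derivative_pos[OF e strict True zR] by simp
  qed
qed

text \<open>In the limit \<open>l \<rightarrow> 0\<close>, used for both \<open>e\<close> and \<open>-e\<close>, the function is invariant under reflections in
  hyperplanes through the origin, and these act transitively on spheres.\<close>
theorem radially_symmetric:
  assumes "norm x = norm y" "norm x > R"
  shows "u x = u y"
proof -
  have le: "u (reflection e 0 x) \<le> u x" if e: "norm e = 1" and x: "x \<bullet> e > 0" "norm x > R" for e x
  proof -
    have "((\<lambda>m. u (reflection e m x)) \<longlongrightarrow> u (reflection e 0 x)) (at_right 0)"
      by (intro tendsto_u tendsto_intros)
    moreover have "eventually (\<lambda>m. u (reflection e m x) \<le> u x) (at_right 0)"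
      unfolding eventually_at_right_field
      using reflection_decreases[OF e] x by (intro exI[of _ "x \<bullet> e"]) (auto simp: less_imp_le)
    ultimately show ?thesis by (intro tendsto_upperbound) auto
  qed
  have le': "u x \<le> u y" if ne: "x \<noteq> y" and eq: "norm x = norm y" "norm y > R" for x y
  proof -
    define e where "e = (y - x) /\<^sub>R norm (y - x)"
    have e: "norm e = 1" using ne by (simp add: e_def)
    have sq: "(norm (y - x))\<^sup>2 = 2 * (y \<bullet> (y - x))"
      using eq(1) unfolding power2_norm_eq_inner norm_eq
      by (simp add: algebra_simps inner_commute)
    have n: "norm (y - x) > 0" using ne by simp
    have ye: "2 * (y \<bullet> e) = norm (y - x)"
    proof -
      have "norm (y - x) * (2 * (y \<bullet> e)) = 2 * (y \<bullet> (y - x))" using n by (simp add: e_def)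
      then have "norm (y - x) * (2 * (y \<bullet> e)) = norm (y - x) * norm (y - x)"
        using sq by (simp add: power2_eq_square)
      then show ?thesis using n by simp
    qed
    then have "reflection e 0 y = x"
      using n by (simp add: reflection_def e_def)
    moreover have "y \<bullet> e > 0" using ye n by linarith
    ultimately show ?thesis using le[OF e _ eq(2)] by auto
  qed
  show ?thesis using le'[of x y] le'[of y x] assms by (cases "x = y") auto
qed

lemma increasing_along_rays:
  assumes "norm e = 1" "R < s" "s < t"
  shows "u (s *\<^sub>R e) < u (t *\<^sub>R e)"
proof -
  have ee: "e \<bullet> e = 1" using assms by (simp add: norm_eq_1)
  have "t - 2 * (t - (s + t) / 2) = s" by (simp add: field_simps)
  then have "reflection e ((s + t) / 2) (t *\<^sub>R e) = s *\<^sub>R e"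
    by (simp add: reflection_def ee flip: scaleR_diff_left)
  then show ?thesis
    using reflection_decreases[of e "(s + t) / 2" "t *\<^sub>R e"] assms ee R_pos by simp
qed

end

section \<open>Comparison along spirals in nearly circular annuli\<close>

text \<open>Counterclockwise rotation by a right angle. For \<open>a\<close> the gradient of \<open>u\<close>, the polar derivatives are
  \<open>r u\<^sub>r = a x \<bullet> x\<close> and \<open>u\<^sub>\<theta> = a x \<bullet> rot90 x\<close>.\<close>
definition rot90 :: "real^2 \<Rightarrow> real^2" where
  "rot90 x = vector [- (x $ 2), x $ 1]"

lemma rot90_component [simp]: "rot90 x $ 1 = - (x $ 2)" "rot90 x $ 2 = x $ 1"
  by (simp_all add: rot90_def)

lemma inner_real2: "(x::real^2) \<bullet> y = x $ 1 * y $ 1 + x $ 2 * y $ 2"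
  by (simp add: inner_vec_def sum_2)

lemma sin_ge_half:
  assumes "0 \<le> t" "t \<le> pi / 2"
  shows "t / 2 \<le> sin t"
proof (cases "t \<le> pi / 3")
  case True
  have "sin 0 - 0 / 2 \<le> sin t - t / 2"
  proof (rule DERIV_nonneg_imp_nondecreasing[OF assms(1)])
    fix x assume x: "0 \<le> x" "x \<le> t"
    have "cos (pi / 3) \<le> cos x" using x True by (intro cos_monotone_0_pi_le) auto
    then show "\<exists>y. ((\<lambda>t. sin t - t / 2) has_real_derivative y) (at x) \<and> 0 \<le> y"
      by (intro exI[of _ "cos x - 1 / 2"]) (auto intro!: derivative_eq_intros simp: cos_60)
  qed
  then show ?thesis by simp
next
  case False
  have "sin (pi / 3) \<le> sin t" using False assms by (intro sin_monotone_2pi_le) auto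
  moreover have "(1.7 :: real) \<le> sqrt 3" by (intro real_le_rsqrt) (simp add: power2_eq_square)
  ultimately show ?thesis using assms pi_less_4 pi_approx by (simp add: sin_60)
qed

lemma polar_coordinates_close:
  fixes x y :: "real^2"
  assumes "x \<noteq> 0" "y \<noteq> 0"
  obtains \<alpha> \<gamma> where "x = norm x *\<^sub>R vector [cos \<alpha>, sin \<alpha>]"
    "y = norm y *\<^sub>R vector [cos (\<alpha> + \<gamma>), sin (\<alpha> + \<gamma>)]" "\<bar>\<gamma>\<bar> \<le> pi"
proof -
  define X where "X = Complex (x $ 1) (x $ 2)"
  define Y where "Y = Complex (y $ 1) (y $ 2)"
  have n: "cmod X = norm x" "cmod Y = norm y"
    by (simp_all add: X_def Y_def cmod_def norm_eq_sqrt_inner inner_real2 power2_eq_square)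
  define \<alpha> where "\<alpha> = Arg X"
  define \<gamma> where "\<gamma> = Arg (Y / X)"
  have X: "X = rcis (norm x) \<alpha>" using rcis_cmod_Arg[of X] n by (simp add: \<alpha>_def)
  have "Y = X * (Y / X)" using n assms by auto
  also have "\<dots> = rcis (norm x) \<alpha> * rcis (norm y / norm x) \<gamma>"
    using X rcis_cmod_Arg[of "Y / X"] n by (simp add: \<gamma>_def norm_divide)
  also have "\<dots> = rcis (norm y) (\<alpha> + \<gamma>)" using assms by (simp add: rcis_mult)
  finally have Y: "Y = rcis (norm y) (\<alpha> + \<gamma>)" .
  have "x $ 1 = Re X" "x $ 2 = Im X" "y $ 1 = Re Y" "y $ 2 = Im Y" by (simp_all add: X_def Y_def)
  moreover have "Re X = norm x * cos \<alpha>" "Im X = norm x * sin \<alpha>"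
    "Re Y = norm y * cos (\<alpha> + \<gamma>)" "Im Y = norm y * sin (\<alpha> + \<gamma>)"
    using arg_cong[OF X, of Re] arg_cong[OF X, of Im] arg_cong[OF Y, of Re] arg_cong[OF Y, of Im]
    unfolding Re_rcis Im_rcis by blast+
  moreover have "\<bar>\<gamma>\<bar> \<le> pi" using Arg_bounded[of "Y / X"] by (simp add: \<gamma>_def abs_le_iff)
  ultimately show ?thesis
    by (intro that[of \<alpha> \<gamma>]) (simp_all add: vec_eq_iff forall_2)
qed

lemma angle_le_distance:
  fixes x y :: "real^2"
  assumes x: "x = norm x *\<^sub>R vector [cos \<alpha>, sin \<alpha>]"
    and y: "y = norm y *\<^sub>R vector [cos (\<alpha> + \<gamma>), sin (\<alpha> + \<gamma>)]" and "\<bar>\<gamma>\<bar> \<le> pi"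
    and le: "norm y \<le> norm x"
  shows "norm y * \<bar>\<gamma>\<bar> \<le> 2 * norm (x - y)"
proof -
  have "x \<bullet> y = norm x * norm y * (cos \<alpha> * cos (\<alpha> + \<gamma>) + sin \<alpha> * sin (\<alpha> + \<gamma>))"
    by (subst x, subst y) (simp add: inner_real2 algebra_simps)
  also have "cos \<alpha> * cos (\<alpha> + \<gamma>) + sin \<alpha> * sin (\<alpha> + \<gamma>) = cos \<gamma>"
    using cos_diff[of "\<alpha> + \<gamma>" \<alpha>] by (simp add: mult.commute)
  finally have xy: "x \<bullet> y = norm x * norm y * cos \<gamma>" .
  have "(norm (x - y))\<^sup>2 = (norm x - norm y)\<^sup>2 + 2 * (norm x * norm y) * (1 - cos \<gamma>)"
  proof -
    have "(norm (x - y))\<^sup>2 = (norm x)\<^sup>2 + (norm y)\<^sup>2 - 2 * (x \<bullet> y)"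
      unfolding power2_norm_eq_inner by (simp add: inner_diff_left inner_diff_right inner_commute)
    then show ?thesis by (simp add: xy power2_eq_square algebra_simps)
  qed
  also have "1 - cos \<gamma> = 2 * (sin (\<bar>\<gamma>\<bar> / 2))\<^sup>2"
    using cos_double_sin[of "\<bar>\<gamma>\<bar> / 2"] by simp
  finally have "(norm (x - y))\<^sup>2 = (norm x - norm y)\<^sup>2 + 2 * (norm x * norm y) * (2 * (sin (\<bar>\<gamma>\<bar> / 2))\<^sup>2)" .
  moreover have "2 * (norm y * norm y) * (2 * (\<bar>\<gamma>\<bar> / 2 / 2)\<^sup>2) \<le> 2 * (norm x * norm y) * (2 * (sin (\<bar>\<gamma>\<bar> / 2))\<^sup>2)"
    using le sin_ge_half[of "\<bar>\<gamma>\<bar> / 2"] assms(3)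
    by (intro mult_mono power_mono) auto
  moreover have "(norm y * \<bar>\<gamma>\<bar> / 2)\<^sup>2 = 2 * (norm y * norm y) * (2 * (\<bar>\<gamma>\<bar> / 2 / 2)\<^sup>2)"
    by (simp add: power_divide power_mult_distrib power2_eq_square)
  moreover have "(norm x - norm y)\<^sup>2 \<ge> 0" by simp
  ultimately have "(norm y * \<bar>\<gamma>\<bar> / 2)\<^sup>2 \<le> (norm (x - y))\<^sup>2" by linarith
  then have "norm y * \<bar>\<gamma>\<bar> / 2 \<le> norm (x - y)" by (rule power2_le_imp_le) simp
  then show ?thesis by simp
qed

text \<open>If \<open>|u\<^sub>\<theta>| \<le> \<eta> u\<^sub>r\<close> in the annulus between the circles through \<open>y\<close> and \<open>x\<close>, then \<open>u\<close> increases along the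
  spiral from \<open>y\<close> to \<open>x\<close> on which radius and angle are affine functions of the parameter, as soon as
  the radius grows fast enough compared with the angle.\<close>
lemma increasing_along_spiral:
  fixes u :: "real^2 \<Rightarrow> real"
  assumes grad: "\<And>z. (u has_derivative (\<lambda>h. a z \<bullet> h)) (at z)"
    and x: "x = norm x *\<^sub>R vector [cos \<alpha>, sin \<alpha>]"
    and y: "y = norm y *\<^sub>R vector [cos (\<alpha> + \<gamma>), sin (\<alpha> + \<gamma>)]"
    and radial: "\<And>z. norm y \<le> norm z \<Longrightarrow> norm z \<le> norm x \<Longrightarrow> a z \<bullet> z > 0"
    and angular: "\<And>z. norm y \<le> norm z \<Longrightarrow> norm z \<le> norm x \<Longrightarrow> norm z * \<bar>a z \<bullet> rot90 z\<bar> \<le> \<eta> * (a z \<bullet> z)"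
    and less: "norm y < norm x" "\<eta> * \<bar>\<gamma>\<bar> < norm x - norm y" and "y \<noteq> 0"
  shows "u y < u x"
proof -
  define \<rho> where "\<rho> = (\<lambda>s. norm y + s * (norm x - norm y))"
  define \<theta> where "\<theta> = (\<lambda>s. \<alpha> + (1 - s) * \<gamma>)"
  define E where "E = (\<lambda>t. cos t *\<^sub>R axis 1 1 + sin t *\<^sub>R axis 2 (1::real) :: real^2)"
  have E: "E t = vector [cos t, sin t]" for t
    by (simp add: E_def vec_eq_iff forall_2 axis_def)
  define z where "z = (\<lambda>s. \<rho> s *\<^sub>R E (\<theta> s))"
  define z' where "z' = (\<lambda>s. (norm x - norm y) *\<^sub>R E (\<theta> s) - \<gamma> *\<^sub>R rot90 (z s))"
  have z: "(z has_vector_derivative z' s) (at s)" for s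
    unfolding z_def z'_def E_def \<rho>_def \<theta>_def has_vector_derivative_def
    by (auto intro!: derivative_eq_intros simp: fun_eq_iff vec_eq_iff forall_2 axis_def algebra_simps)
  have normE: "norm (E t) = 1" for t
    by (simp add: norm_eq_1 inner_real2 E flip: power2_eq_square)
  have pos: "a (z s) \<bullet> z' s > 0" if "0 \<le> s" "s \<le> 1" for s
  proof -
    have \<rho>: "norm y \<le> \<rho> s" "\<rho> s \<le> norm x"
      unfolding \<rho>_def using that less(1) mult_nonneg_nonneg[of s "norm x - norm y"]
        mult_left_le_one_le[of "norm x - norm y" s] by linarith+
    have "norm y > 0" using \<open>y \<noteq> 0\<close> by simp
    then have \<rho>0: "\<rho> s > 0" using \<rho> by linarith
    have nz: "norm (z s) = \<rho> s" using \<rho>0 normE by (simp add: z_def)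
    have rad: "a (z s) \<bullet> z s > 0" and ang: "\<rho> s * \<bar>a (z s) \<bullet> rot90 (z s)\<bar> \<le> \<eta> * (a (z s) \<bullet> z s)"
      using radial[of "z s"] angular[of "z s"] nz \<rho> by auto
    have "\<rho> s * (a (z s) \<bullet> z' s) = (norm x - norm y) * (a (z s) \<bullet> z s) - \<gamma> * (\<rho> s * (a (z s) \<bullet> rot90 (z s)))"
      by (simp add: z'_def z_def inner_diff_right algebra_simps)
    moreover have "\<gamma> * (\<rho> s * (a (z s) \<bullet> rot90 (z s))) \<le> \<bar>\<gamma>\<bar> * (\<rho> s * \<bar>a (z s) \<bullet> rot90 (z s)\<bar>)"
      using \<rho>0 abs_ge_self[of "\<gamma> * (\<rho> s * (a (z s) \<bullet> rot90 (z s)))"] by (simp add: abs_mult)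
    moreover have "\<bar>\<gamma>\<bar> * (\<rho> s * \<bar>a (z s) \<bullet> rot90 (z s)\<bar>) \<le> \<bar>\<gamma>\<bar> * (\<eta> * (a (z s) \<bullet> z s))"
      using ang by (intro mult_left_mono) auto
    moreover have "(norm x - norm y - \<eta> * \<bar>\<gamma>\<bar>) * (a (z s) \<bullet> z s) > 0" using rad less(2) by simp
    ultimately have "\<rho> s * (a (z s) \<bullet> z' s) > 0" by (simp add: algebra_simps)
    then show ?thesis using \<rho>0 by (simp add: zero_less_mult_iff)
  qed
  have "((\<lambda>s. u (z s)) has_real_derivative a (z s) \<bullet> z' s) (at s)" for s
  proof -
    have "((\<lambda>s. u (z s)) has_derivative (\<lambda>h. a (z s) \<bullet> (h *\<^sub>R z' s))) (at s)"
      using has_derivative_compose[OF z[unfolded has_vector_derivative_def] grad] .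
    then show ?thesis by (simp add: has_field_derivative_def mult.commute[of _ "a (z s) \<bullet> z' s"] cong: fun_eq_iff)
  qed
  then have "u (z 0) < u (z 1)"
    using pos by (intro DERIV_pos_imp_increasing[of 0 1 "\<lambda>s. u (z s)"]) auto
  moreover have "z 0 = y" using y by (simp add: z_def \<rho>_def \<theta>_def E)
  moreover have "z 1 = x" using x by (simp add: z_def \<rho>_def \<theta>_def E)
  ultimately show ?thesis by simp
qed

text \<open>The comparison with the reflection in an annulus where the level curves are nearly circles. With
  \<open>d\<close> the distance of \<open>x\<close> to the line, the radii differ by \<open>4 l d / (|x| + |y|)\<close> while the angle between
  \<open>x\<close> and \<open>y\<close> is at most \<open>4 d / |y|\<close>, so the spiral is steep enough if \<open>\<eta>\<close> is small compared with \<open>l\<close>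
  and \<open>|y|\<close>.\<close>
lemma reflection_decreases_near_ends:
  fixes u :: "real^2 \<Rightarrow> real"
  assumes grad: "\<And>z. (u has_derivative (\<lambda>h. a z \<bullet> h)) (at z)"
    and e: "norm e = 1" and l: "l > 0" and x: "x \<bullet> e > l" and y: "y = reflection e l x" "y \<noteq> 0"
    and \<eta>: "0 \<le> \<eta>" "8 * \<eta> \<le> l" "8 * \<eta> \<le> norm y"
    and radial: "\<And>z. norm y \<le> norm z \<Longrightarrow> norm z \<le> norm x \<Longrightarrow> a z \<bullet> z > 0"
    and angular: "\<And>z. norm y \<le> norm z \<Longrightarrow> norm z \<le> norm x \<Longrightarrow> norm z * \<bar>a z \<bullet> rot90 z\<bar> \<le> \<eta> * (a z \<bullet> z)"
  shows "u y < u x"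
proof -
  have ee: "e \<bullet> e = 1" using e by (simp add: norm_eq_1)
  define d where "d = x \<bullet> e - l"
  have d: "d > 0" using x by (simp add: d_def)
  have sq: "(norm y)\<^sup>2 = (norm x)\<^sup>2 - 4 * l * d"
    using norm_reflection_sq[OF e] y by (simp add: d_def)
  have "4 * l * d > 0" using l d by simp
  then have "(norm y)\<^sup>2 < (norm x)\<^sup>2" using sq by linarith
  then have less: "norm y < norm x" by (rule power_less_imp_less_base) simp
  have xy: "x - y = (2 * d) *\<^sub>R e" by (simp add: y reflection_def d_def)
  then have nxy: "norm (x - y) = 2 * d" using e d by simp
  have "y \<bullet> e = l - d" using ee by (simp add: y reflection_def d_def inner_diff_left)
  then have "d - l \<le> norm y" using Cauchy_Schwarz_ineq2[of y e] e by simp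
  moreover have "norm x \<le> norm y + 2 * d" using norm_triangle_ineq[of y "x - y"] nxy by simp
  ultimately have nx: "norm x + norm y \<le> 4 * norm y + 2 * l" by linarith
  have ny: "norm y > 0" using y by simp
  have "x \<noteq> 0" using less by auto
  then obtain \<alpha> \<gamma> where p: "x = norm x *\<^sub>R vector [cos \<alpha>, sin \<alpha>]"
    "y = norm y *\<^sub>R vector [cos (\<alpha> + \<gamma>), sin (\<alpha> + \<gamma>)]" "\<bar>\<gamma>\<bar> \<le> pi"
    using polar_coordinates_close y(2) by blast
  have \<gamma>: "norm y * \<bar>\<gamma>\<bar> \<le> 4 * d" using angle_le_distance[OF p] less nxy by simp
  have "norm y * (norm x + norm y) * (\<eta> * \<bar>\<gamma>\<bar>) = \<eta> * (norm x + norm y) * (norm y * \<bar>\<gamma>\<bar>)" by simp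
  also have "\<dots> \<le> \<eta> * (4 * norm y + 2 * l) * (4 * d)"
    using \<eta> l ny by (intro mult_mono[OF mult_left_mono[OF nx] \<gamma>]) auto
  also have "\<dots> = (2 * ((8 * \<eta>) * norm y) + l * (8 * \<eta>)) * d" by (simp add: algebra_simps)
  also have "\<dots> \<le> (2 * (l * norm y) + l * norm y) * d"
    using \<eta> l d ny by (intro mult_right_mono add_mono mult_left_mono) auto
  also have "\<dots> < norm y * (4 * l * d)" using l d ny by (simp add: algebra_simps)
  also have "\<dots> = norm y * (norm x + norm y) * (norm x - norm y)"
  proof -
    have "4 * l * d = (norm x + norm y) * (norm x - norm y)"
      using sq by (simp add: power2_eq_square algebra_simps)
    then show ?thesis by simp
  qed
  finally have "\<eta> * \<bar>\<gamma>\<bar> < norm x - norm y"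
    using ny less by (simp add: mult_less_cancel_left add_pos_pos not_less zero_less_mult_iff)
  then show ?thesis
    by (intro increasing_along_spiral[OF grad p(1,2) radial angular less]) (use y in auto)
qed

section \<open>Components of sublevel sets and first integrals\<close>

lemma component_of_sublevel_set_has_min:
  fixes f :: "'a::euclidean_space \<Rightarrow> real"
  assumes cont: "continuous_on UNIV f" and C: "C \<in> components {x. f x < t}" and "bounded C"
  shows "\<exists>z\<in>C. \<forall>y\<in>C. f z \<le> f y"
proof -
  have op: "open {x. f x < t}"
    by (intro open_Collect_less cont continuous_on_const)
  have "compact (closure C)" "closure C \<noteq> {}"
    using \<open>bounded C\<close> in_components_nonempty[OF C] by (auto simp: compact_closure)
  then obtain z where z: "z \<in> closure C" "\<And>y. y \<in> closure C \<Longrightarrow> f z \<le> f y"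
    using continuous_attains_inf[of "closure C" f] continuous_on_subset[OF cont] by blast
  obtain w where "w \<in> C" using in_components_nonempty[OF C] by blast
  then have "f w < t" "f z \<le> f w" using in_components_subset[OF C] z(2) closure_subset by auto
  then have "z \<in> {x. f x < t}" by simp
  then have "z \<notin> frontier {x. f x < t}" using op by (simp add: frontier_def interior_open)
  then have "z \<notin> frontier C" using frontier_of_components_subset[OF C] by blast
  then have "z \<in> C" using z(1) open_components[OF op C] by (simp add: frontier_def interior_open)
  then show ?thesis using z(2) closure_subset by blast
qed

lemma connected_if_components_share_point:
  assumes "\<And>C. C \<in> components S \<Longrightarrow> p \<in> C"
  shows "connected S"
proof -
  have "connected (\<Union>(components S))"
    using assms by (intro connected_Union) (auto intro: in_components_connected)
  then show ?thesis by (metis Union_components)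
qed

text \<open>If the derivative of \<open>f\<close> vanishes on the tangent directions of the level curves of \<open>u\<close>, then \<open>f\<close> is
  constant on them near every regular point \<open>x0\<close>. In the coordinates \<open>s\<close>, \<open>t\<close> along the tangent \<open>b\<close> and the
  normal \<open>e\<close> at \<open>x0\<close> the level curve is a Lipschitz graph, and \<open>f\<close> has derivative 0 along it.\<close>
lemma first_integral_locally_constant:
  fixes u f :: "real^2 \<Rightarrow> real"
  assumes u: "\<And>x. (u has_derivative (\<lambda>h. a x \<bullet> h)) (at x)"
    and a: "continuous_on UNIV a"
    and f: "\<And>x. (f has_derivative F x) (at x)"
    and tangential: "\<And>x h. a x \<noteq> 0 \<Longrightarrow> a x \<bullet> h = 0 \<Longrightarrow> F x h = 0"
    and nz: "a x0 \<noteq> 0"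
  shows "\<exists>d>0. \<forall>y\<in>ball x0 d. u y = u x0 \<longrightarrow> f y = f x0"
proof -
  define n where "n = norm (a x0)"
  have n: "n > 0" using nz by (simp add: n_def)
  define e where "e = a x0 /\<^sub>R n"
  define b where "b = rot90 e"
  have ee: "e \<bullet> e = 1" and aee: "a x0 = n *\<^sub>R e" using n
    by (auto simp: e_def n_def power2_norm_eq_inner[symmetric] power2_eq_square field_simps)
  have eb: "e \<bullet> b = 0" "b \<bullet> e = 0" "b \<bullet> b = 1"
    using ee by (auto simp: b_def inner_real2 algebra_simps)
  have norms: "norm e = 1" "norm b = 1" using ee eb by (auto simp: norm_eq_1)
  have decompose: "y = (y \<bullet> b) *\<^sub>R b + (y \<bullet> e) *\<^sub>R e" for y :: "real^2"
  proof -
    have 1: "(e $ 1)\<^sup>2 + (e $ 2)\<^sup>2 = 1" using ee by (simp add: inner_real2 power2_eq_square)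
    have "y $ 1 = y $ 1 * ((e $ 1)\<^sup>2 + (e $ 2)\<^sup>2)" "y $ 2 = y $ 2 * ((e $ 1)\<^sup>2 + (e $ 2)\<^sup>2)" using 1 by simp_all
    then show ?thesis by (simp add: vec_eq_iff forall_2 b_def inner_real2 algebra_simps power2_eq_square)
  qed
  obtain r where r: "r > 0" "\<And>z. dist z x0 < r \<Longrightarrow> dist (a z) (a x0) < n / 4"
    using a n unfolding continuous_on_iff by (metis UNIV_I zero_less_divide_iff zero_less_numeral)
  have az: "a z \<bullet> e \<ge> 3 * n / 4" "\<bar>a z \<bullet> b\<bar> \<le> n / 4" if "dist z x0 < r" for z
  proof -
    have d: "norm (a z - n *\<^sub>R e) < n / 4" using r(2)[OF that] by (simp add: dist_norm aee)
    have "\<bar>(a z - n *\<^sub>R e) \<bullet> e\<bar> \<le> n / 4" "\<bar>(a z - n *\<^sub>R e) \<bullet> b\<bar> \<le> n / 4"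
      using Cauchy_Schwarz_ineq2[of "a z - n *\<^sub>R e" e] Cauchy_Schwarz_ineq2[of "a z - n *\<^sub>R e" b] d norms by auto
    moreover have "(a z - n *\<^sub>R e) \<bullet> e = a z \<bullet> e - n" "(a z - n *\<^sub>R e) \<bullet> b = a z \<bullet> b"
      using ee eb by (auto simp: inner_diff_left)
    ultimately show "a z \<bullet> e \<ge> 3 * n / 4" "\<bar>a z \<bullet> b\<bar> \<le> n / 4" by linarith+
  qed
  define \<rho> where "\<rho> = r / 3"
  have \<rho>: "\<rho> > 0" using r by (simp add: \<rho>_def)
  define P where "P = (\<lambda>s t. x0 + s *\<^sub>R b + t *\<^sub>R e)"
  have inb: "P s t \<in> ball x0 r" if "\<bar>s\<bar> \<le> \<rho>" "\<bar>t\<bar> \<le> \<rho>" for s t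
  proof -
    have "norm (s *\<^sub>R b + t *\<^sub>R e) \<le> \<bar>s\<bar> + \<bar>t\<bar>"
      using norm_triangle_ineq[of "s *\<^sub>R b" "t *\<^sub>R e"] norms by simp
    also have "\<dots> < r" using that r by (simp add: \<rho>_def)
    finally have "norm (P s t - x0) < r" by (simp add: P_def add.assoc)
    then show ?thesis by (simp add: dist_norm norm_minus_commute)
  qed
  have mvt: "\<exists>z. dist z x0 < r \<and> u (P s' t') - u (P s t) = (s' - s) * (a z \<bullet> b) + (t' - t) * (a z \<bullet> e)"
    if "\<bar>s\<bar> \<le> \<rho>" "\<bar>t\<bar> \<le> \<rho>" "\<bar>s'\<bar> \<le> \<rho>" "\<bar>t'\<bar> \<le> \<rho>" for s t s' t'
  proof -
    define h where "h = P s' t' - P s t"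
    have "((\<lambda>x. u (P s t + x *\<^sub>R h)) has_real_derivative a (P s t + x *\<^sub>R h) \<bullet> h) (at x)" for x
      by (rule has_real_derivative_along_line[OF u])
    then obtain x where x: "0 < x" "x < 1" "u (P s t + 1 *\<^sub>R h) - u (P s t + 0 *\<^sub>R h) = (1 - 0) * (a (P s t + x *\<^sub>R h) \<bullet> h)"
      using MVT2[of 0 1 "\<lambda>x. u (P s t + x *\<^sub>R h)" "\<lambda>x. a (P s t + x *\<^sub>R h) \<bullet> h"] by auto
    have "P s t + x *\<^sub>R h = (1 - x) *\<^sub>R P s t + x *\<^sub>R P s' t'" by (simp add: h_def algebra_simps)
    then have "P s t + x *\<^sub>R h \<in> ball x0 r"
      using convexD_alt[OF convex_ball inb[OF that(1,2)] inb[OF that(3,4)], of x] x by simp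
    moreover have "h = (s' - s) *\<^sub>R b + (t' - t) *\<^sub>R e" by (simp add: h_def P_def algebra_simps)
    moreover have "u (P s' t') - u (P s t) = a (P s t + x *\<^sub>R h) \<bullet> h" using x(3) by (simp add: h_def)
    ultimately show ?thesis
      by (intro exI[of _ "P s t + x *\<^sub>R h"]) (simp add: dist_commute inner_add_right)
  qed
  \<comment> \<open>On the square, the level curve through \<open>x0\<close> is the graph of a function with slope at most 1.\<close>
  have slope: "\<bar>t' - t\<bar> \<le> \<bar>s' - s\<bar>"
    if level: "\<bar>s\<bar> \<le> \<rho>" "\<bar>t\<bar> \<le> \<rho>" "\<bar>s'\<bar> \<le> \<rho>" "\<bar>t'\<bar> \<le> \<rho>" "u (P s' t') = u (P s t)" for s t s' t'
  proof -
    obtain z where z: "dist z x0 < r" "(s' - s) * (a z \<bullet> b) + (t' - t) * (a z \<bullet> e) = 0"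
      using mvt[OF level(1-4)] level(5) by auto
    have "\<bar>t' - t\<bar> * (n / 4) \<le> \<bar>t' - t\<bar> * (a z \<bullet> e)"
      using az[OF z(1)] n by (intro mult_left_mono) auto
    also have "\<dots> = \<bar>(t' - t) * (a z \<bullet> e)\<bar>" using az(1)[OF z(1)] n by (simp add: abs_mult)
    also have "(t' - t) * (a z \<bullet> e) = - ((s' - s) * (a z \<bullet> b))" using z(2) by linarith
    also have "\<bar>- ((s' - s) * (a z \<bullet> b))\<bar> \<le> \<bar>s' - s\<bar> * (n / 4)"
      using mult_left_mono[OF az(2)[OF z(1)] abs_ge_zero[of "s' - s"]] by (simp add: abs_mult)
    finally show ?thesis using n by simp
  qed
  have "\<exists>t. \<bar>t\<bar> \<le> \<rho> \<and> u (P s t) = u x0" if s: "\<bar>s\<bar> \<le> \<rho>" for s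
  proof -
    have P0: "P 0 0 = x0" by (simp add: P_def)
    obtain z where z: "dist z x0 < r" "u (P s \<rho>) - u x0 = s * (a z \<bullet> b) + \<rho> * (a z \<bullet> e)"
      using mvt[of 0 0 s \<rho>] s \<rho> P0 by auto
    obtain z' where z': "dist z' x0 < r" "u (P s (- \<rho>)) - u x0 = s * (a z' \<bullet> b) - \<rho> * (a z' \<bullet> e)"
      using mvt[of 0 0 s "- \<rho>"] s \<rho> P0 by auto
    have small: "\<bar>s * (a z \<bullet> b)\<bar> \<le> \<rho> * (n / 4)" "\<rho> * (n / 4) \<le> \<rho> * (a z \<bullet> e)" if "dist z x0 < r" for z
    proof -
      show "\<bar>s * (a z \<bullet> b)\<bar> \<le> \<rho> * (n / 4)"
        unfolding abs_mult using az(2)[OF that] s \<rho> by (intro mult_mono) auto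
      show "\<rho> * (n / 4) \<le> \<rho> * (a z \<bullet> e)"
        using az(1)[OF that] n \<rho> by (intro mult_left_mono) auto
    qed
    have "u (P s (- \<rho>)) \<le> u x0" "u x0 \<le> u (P s \<rho>)" using small[OF z(1)] small[OF z'(1)] z(2) z'(2) by auto
    moreover have "continuous_on {- \<rho>..\<rho>} (\<lambda>t. u (P s t))"
      unfolding P_def by (intro continuous_at_imp_continuous_on ballI
        has_derivative_continuous[OF has_real_derivative_along_line[OF u, unfolded has_field_derivative_def]])
    ultimately obtain t where "- \<rho> \<le> t" "t \<le> \<rho>" "u (P s t) = u x0"
      using IVT'[of "\<lambda>t. u (P s t)" "- \<rho>" "u x0" \<rho>] \<rho> by auto
    then show ?thesis by (intro exI[of _ t]) auto
  qed
  then obtain g where g: "\<And>s. \<bar>s\<bar> \<le> \<rho> \<Longrightarrow> \<bar>g s\<bar> \<le> \<rho>" "\<And>s. \<bar>s\<bar> \<le> \<rho> \<Longrightarrow> u (P s (g s)) = u x0" by metis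
  define h where "h = (\<lambda>s. f (P s (g s)))"
  have h': "(h has_derivative (\<lambda>_. 0)) (at s within {- \<rho>..\<rho>})" if s: "s \<in> {- \<rho>..\<rho>}" for s
    unfolding has_derivative_within_alt
  proof (intro conjI allI impI)
    fix \<epsilon> :: real assume \<epsilon>: "\<epsilon> > 0"
    define p where "p = P s (g s)"
    define k where "k = F p (a p) / (a p \<bullet> a p)"
    have sr: "\<bar>s\<bar> \<le> \<rho>" using s by auto
    have Fk: "F p v - k * (a p \<bullet> v) = 0" for v
    proof -
      have "dist p x0 < r" using inb[of s "g s"] sr g(1)[OF sr] by (simp add: p_def dist_commute)
      then have "a p \<bullet> e \<noteq> 0" using az(1)[of p] n by auto
      then have nz: "a p \<noteq> 0" by auto
      then have "a p \<bullet> (v - (a p \<bullet> v / (a p \<bullet> a p)) *\<^sub>R a p) = 0" by (simp add: inner_diff_right)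
      then have "F p (v - (a p \<bullet> v / (a p \<bullet> a p)) *\<^sub>R a p) = 0" by (rule tangential[OF nz])
      then show ?thesis
        by (simp add: k_def linear_diff[OF has_derivative_linear[OF f]] linear_scale[OF has_derivative_linear[OF f]])
    qed
    \<comment> \<open>\<open>k\<close> is the factor by which the gradient of \<open>f\<close> at \<open>p\<close> is a multiple of that of \<open>u\<close>; on the
      level curve, \<open>f - k u\<close> has the same increments as \<open>f\<close>.\<close>
    have "((\<lambda>y. f y - k * u y) has_derivative (\<lambda>v. F p v - k * (a p \<bullet> v))) (at p)"
      by (auto intro!: derivative_eq_intros f u)
    then have "((\<lambda>y. f y - k * u y) has_derivative (\<lambda>v. 0)) (at p)" by (simp add: Fk)
    then obtain d where d: "d > 0" "\<And>y. norm (y - p) < d \<Longrightarrow>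
        norm ((f y - k * u y) - (f p - k * u p) - 0) \<le> \<epsilon> / 2 * norm (y - p)"
      unfolding has_derivative_at_alt using \<epsilon> by (metis half_gt_zero)
    show "\<exists>d>0. \<forall>y\<in>{- \<rho>..\<rho>}. norm (y - s) < d \<longrightarrow> norm (h y - h s - 0) \<le> \<epsilon> * norm (y - s)"
    proof (intro exI[of _ "d / 2"] conjI ballI impI)
      fix s' assume s': "s' \<in> {- \<rho>..\<rho>}" and close: "norm (s' - s) < d / 2"
      define p' where "p' = P s' (g s')"
      have s'r: "\<bar>s'\<bar> \<le> \<rho>" using s' by auto
      have "\<bar>g s' - g s\<bar> \<le> \<bar>s' - s\<bar>" using g sr s'r by (intro slope) auto
      moreover have "p' - p = (s' - s) *\<^sub>R b + (g s' - g s) *\<^sub>R e" by (simp add: p'_def p_def P_def algebra_simps)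
      ultimately have np: "norm (p' - p) \<le> 2 * \<bar>s' - s\<bar>"
        using norm_triangle_ineq[of "(s' - s) *\<^sub>R b" "(g s' - g s) *\<^sub>R e"] norms by simp
      then have "norm (p' - p) < d" using close by simp
      from d(2)[OF this] have "\<bar>f p' - f p\<bar> \<le> \<epsilon> / 2 * norm (p' - p)"
        using g(2)[OF sr] g(2)[OF s'r] by (simp add: p_def p'_def)
      also have "\<dots> \<le> \<epsilon> / 2 * (2 * \<bar>s' - s\<bar>)" using np \<epsilon> by (intro mult_left_mono) auto
      finally show "norm (h s' - h s - 0) \<le> \<epsilon> * norm (s' - s)" by (simp add: h_def p_def p'_def)
    qed (use d in simp)
  qed simp
  have hconst: "h s = h 0" if "\<bar>s\<bar> \<le> \<rho>" for s
  proof -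
    have "s \<in> {- \<rho>..\<rho>}" "0 \<in> {- \<rho>..\<rho>}" using that \<rho> by auto
    from has_derivative_zero_unique[OF _ h' this] show ?thesis by simp
  qed
  show ?thesis
  proof (intro exI[of _ \<rho>] conjI ballI impI)
    fix y assume y: "y \<in> ball x0 \<rho>" and eq: "u y = u x0"
    define s where "s = (y - x0) \<bullet> b"
    define t where "t = (y - x0) \<bullet> e"
    have yP: "y = P s t" using decompose[of "y - x0"] by (simp add: P_def s_def t_def algebra_simps)
    have "norm (y - x0) < \<rho>" using y by (simp add: dist_norm norm_minus_commute)
    then have st: "\<bar>s\<bar> \<le> \<rho>" "\<bar>t\<bar> \<le> \<rho>"
      using Cauchy_Schwarz_ineq2[of "y - x0" b] Cauchy_Schwarz_ineq2[of "y - x0" e] norms by (auto simp: s_def t_def)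
    have "\<bar>g s - t\<bar> \<le> \<bar>s - s\<bar>" using st g[OF st(1)] eq yP by (intro slope) auto
    then have "f y = h s" by (simp add: yP h_def)
    also have "\<dots> = h 0" by (rule hconst[OF st(1)])
    also have "\<bar>g 0 - 0\<bar> \<le> \<bar>0 - (0::real)\<bar>" using g[of 0] \<rho> by (intro slope) (auto simp: P_def)
    then have "h 0 = f x0" by (simp add: h_def P_def)
    finally show "f y = f x0" .
  qed (use \<rho> in simp)
qed

section \<open>Stream functions in the exterior of a disk\<close>

text \<open>A stream function \<open>u\<close> of a steady flow at rest exactly in the closed disk of radius \<open>R\<close>: \<open>a\<close>, \<open>A\<close> and \<open>\<omega>\<close>
  are its gradient, Hessian and Laplacian, and \<open>W\<close> is the derivative of \<open>\<omega>\<close>, which vanishes along the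
  flow. The last three assumptions are the behaviour at the ends, in terms of \<open>r u\<^sub>r = a x \<bullet> x\<close> and
  \<open>u\<^sub>\<theta> = a x \<bullet> rot90 x\<close>: \<open>u\<^sub>r\<close> is bounded below by a positive constant near infinity, and
  \<open>|u\<^sub>\<theta>| \<le> \<eta> u\<^sub>r\<close> holds near both ends for every \<open>\<eta> > 0\<close>.\<close>
locale exterior_stream_function =
  fixes u :: "real^2 \<Rightarrow> real" and a :: "real^2 \<Rightarrow> real^2" and A :: "real^2 \<Rightarrow> real^2 \<Rightarrow> real^2"
    and \<omega> :: "real^2 \<Rightarrow> real" and W :: "real^2 \<Rightarrow> real^2 \<Rightarrow> real" and R :: real
  assumes grad: "(u has_derivative (\<lambda>h. a x \<bullet> h)) (at x)"
    and hess: "(a has_derivative A x) (at x)"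
    and vort: "\<omega> x = (\<Sum>b\<in>Basis. A x b \<bullet> b)"
    and vort_deriv: "(\<omega> has_derivative W x) (at x)"
    and vort_Lipschitz: "\<exists>d>0. \<exists>L. \<forall>y\<in>ball x d. \<forall>z\<in>ball x d. \<bar>\<omega> y - \<omega> z\<bar> \<le> L * norm (y - z)"
    and transport: "a x \<noteq> 0 \<Longrightarrow> a x \<bullet> h = 0 \<Longrightarrow> W x h = 0"
    and R_pos: "R > 0"
    and critical_iff: "a x = 0 \<longleftrightarrow> norm x \<le> R"
    and u_zero: "u 0 = 0"
    and radial_far: "\<exists>c>0. \<exists>M. \<forall>x. norm x > M \<longrightarrow> a x \<bullet> x \<ge> c * norm x"
    and angular_near: "\<eta> > 0 \<Longrightarrow> \<exists>d>0. \<forall>x. R < norm x \<and> norm x < R + d \<longrightarrow>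
          a x \<bullet> x > 0 \<and> norm x * \<bar>a x \<bullet> rot90 x\<bar> \<le> \<eta> * (a x \<bullet> x)"
    and angular_far: "\<eta> > 0 \<Longrightarrow> \<exists>M. \<forall>x. norm x > M \<longrightarrow>
          a x \<bullet> x > 0 \<and> norm x * \<bar>a x \<bullet> rot90 x\<bar> \<le> \<eta> * (a x \<bullet> x)"
begin

lemma cont_u: "continuous_on S u"
  by (rule continuous_on_if_has_derivative[OF grad])

lemma cont_a: "continuous_on S a"
  by (rule continuous_on_if_has_derivative[OF hess])

lemma u_inside: "norm x \<le> R \<Longrightarrow> u x = 0"
proof -
  assume x: "norm x \<le> R"
  have "(u has_derivative (\<lambda>h. 0)) (at y within cball 0 R)" if "y \<in> cball 0 R" for y
    using that critical_iff[of y] grad[of y] by (auto intro: has_derivative_at_withinI)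
  then have "u x = u 0"
    using has_derivative_zero_unique[of "cball 0 R" u 0 x] x R_pos by auto
  then show ?thesis by (simp add: u_zero)
qed

lemma u_tends_to_infinity: "\<exists>N. \<forall>x. norm x > N \<longrightarrow> u x > B"
proof -
  obtain c M where c: "c > 0" "\<And>x. norm x > M \<Longrightarrow> a x \<bullet> x \<ge> c * norm x" using radial_far by blast
  define m where "m = max M R + 1"
  have m: "m > M" "m > 0" using R_pos by (auto simp: m_def)
  have "compact (sphere (0::real^2) m)" "sphere (0::real^2) m \<noteq> {}" using m by auto
  then obtain y0 where "\<forall>y\<in>sphere 0 m. u y0 \<le> u y"
    using continuous_attains_inf[OF _ _ cont_u, of "sphere (0::real^2) m"] by blast
  then have y0: "\<And>y. norm y = m \<Longrightarrow> u y0 \<le> u y" by simp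
  have lower: "u x \<ge> u y0 + c * (norm x - m)" if x: "norm x > m" for x
  proof -
    define e where "e = x /\<^sub>R norm x"
    have "x \<noteq> 0" using x m by auto
    then have e: "norm e = 1" "x = norm x *\<^sub>R e" by (auto simp: e_def)
    have "((\<lambda>s. u (0 + s *\<^sub>R e)) has_real_derivative a (0 + s *\<^sub>R e) \<bullet> e) (at s)" for s
      by (rule has_real_derivative_along_line[OF grad])
    then obtain s where s: "m < s" "s < norm x" "u (norm x *\<^sub>R e) - u (m *\<^sub>R e) = (norm x - m) * (a (s *\<^sub>R e) \<bullet> e)"
      using MVT2[OF x, of "\<lambda>s. u (s *\<^sub>R e)" "\<lambda>s. a (s *\<^sub>R e) \<bullet> e"] by auto
    have "c * norm (s *\<^sub>R e) \<le> a (s *\<^sub>R e) \<bullet> (s *\<^sub>R e)" using s m e by (intro c) auto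
    then have "s * c \<le> s * (a (s *\<^sub>R e) \<bullet> e)" using s m e by (simp add: mult.commute)
    then have "c \<le> a (s *\<^sub>R e) \<bullet> e" using s m by simp
    then have "(norm x - m) * c \<le> (norm x - m) * (a (s *\<^sub>R e) \<bullet> e)" using x by (intro mult_left_mono) auto
    moreover have "u y0 \<le> u (m *\<^sub>R e)" using e m by (intro y0) auto
    ultimately show ?thesis using s(3) e(2) by (simp add: mult.commute)
  qed
  show ?thesis
  proof (intro exI[of _ "max m (m + (B - u y0) / c)"] allI impI)
    fix x :: "real^2" assume "norm x > max m (m + (B - u y0) / c)"
    then have x: "norm x > m" "(B - u y0) / c < norm x - m" by auto
    then have "B - u y0 < c * (norm x - m)" using c by (simp add: pos_divide_less_eq mult.commute)
    then show "u x > B" using lower[OF x(1)] by linarith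
  qed
qed

lemma local_extremum_inside:
  assumes "open S" "x \<in> S" "(\<forall>y\<in>S. u y \<le> u x) \<or> (\<forall>y\<in>S. u x \<le> u y)"
  shows "norm x \<le> R"
proof -
  have "(\<lambda>h. a x \<bullet> h) = (\<lambda>h. 0)"
    by (rule differential_zero_maxmin[OF assms(2,1) grad assms(3)])
  then have "a x \<bullet> a x = 0" by (rule fun_cong)
  then show ?thesis using critical_iff by simp
qed

lemma u_outside: "norm x > R \<Longrightarrow> u x > 0"
proof (rule ccontr)
  assume x: "norm x > R" and "\<not> u x > 0"
  then have le: "u x \<le> 0" by simp
  obtain N where N: "\<And>y. norm y > N \<Longrightarrow> u y > 0" using u_tends_to_infinity by blast
  have "cball (0::real^2) (max N (norm x)) \<noteq> {}" by (auto simp: le_max_iff_disj)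
  then obtain z where "\<forall>y\<in>cball 0 (max N (norm x)). u z \<le> u y"
    using continuous_attains_inf[OF compact_cball _ cont_u, of "0::real^2" "max N (norm x)"] by blast
  then have z: "\<And>y. norm y \<le> max N (norm x) \<Longrightarrow> u z \<le> u y" by simp
  have min: "u z \<le> u y" for y
  proof (cases "norm y \<le> max N (norm x)")
    case False
    then have "u y > 0" by (intro N) simp
    then show ?thesis using z[of x] le by simp
  qed (rule z)
  have "norm z \<le> R" using local_extremum_inside[of UNIV z] min by auto
  then have "u x = u z" using min[of x] le u_inside by simp
  then have "norm x \<le> R" using local_extremum_inside[of UNIV x] min by auto
  then show False using x by simp
qed

text \<open>The components of sub- and superlevel sets contain an extremum of \<open>u\<close> unless they are unbounded.
  Since there are no critical points outside the disk, every component of a sublevel set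
  contains the disk, and every component of a superlevel set contains a neighbourhood of
  infinity.\<close>
lemma connected_sublevel:
  assumes t: "t > 0" shows "connected {x. u x < t}"
proof (rule connected_if_components_share_point)
  fix C assume C: "C \<in> components {x. u x < t}"
  obtain N where N: "\<And>x. norm x > N \<Longrightarrow> u x > t" using u_tends_to_infinity by blast
  have "{x. u x < t} \<subseteq> cball 0 N" using N by (force simp: not_less)
  then have "bounded C" using in_components_subset[OF C] bounded_subset by blast
  then obtain z where z: "z \<in> C" "\<forall>y\<in>C. u z \<le> u y"
    using component_of_sublevel_set_has_min[OF cont_u C] by blast
  have "open C" by (rule open_components[OF _ C]) (intro open_Collect_less cont_u continuous_on_const)
  then have "z \<in> cball 0 R" using local_extremum_inside z by simp
  then have "cball 0 R \<subseteq> C"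
    using z(1) u_inside t by (intro components_maximal[OF C connected_cball]) auto
  then show "0 \<in> C" using R_pos by auto
qed

lemma connected_superlevel:
  assumes t: "t > 0" shows "connected {x. u x > t}"
proof -
  obtain N where N: "\<And>x. norm x > N \<Longrightarrow> u x > t" using u_tends_to_infinity by blast
  have DIM: "2 \<le> DIM(real^2)" by simp
  have con: "connected (- cball (0::real^2) N)"
    by (rule connected_complement_bounded_convex) (auto simp: DIM)
  have "- cball (0::real^2) N \<noteq> {}"
    using bounded_subset[OF bounded_cball] not_bounded_UNIV by (metis Compl_empty_eq double_compl bounded_cball)
  then obtain p where p: "p \<in> - cball (0::real^2) N" by blast
  show ?thesis
  proof (rule connected_if_components_share_point)
    fix C assume C: "C \<in> components {x. u x > t}"
    have C': "C \<in> components {x. - u x < - t}" using C by simp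
    have "- cball 0 N \<inter> C \<noteq> {}"
    proof
      assume "- cball 0 N \<inter> C = {}"
      then have "bounded C" by (intro bounded_subset[OF bounded_cball[of 0 N]]) auto
      then obtain z where z: "z \<in> C" "\<forall>y\<in>C. - u z \<le> - u y"
        using component_of_sublevel_set_has_min[OF continuous_on_minus[OF cont_u] C'] by blast
      have "open C" by (rule open_components[OF _ C]) (intro open_Collect_less cont_u continuous_on_const)
      then have "norm z \<le> R" using local_extremum_inside z by simp
      moreover have "u z > t" using z in_components_subset[OF C] by auto
      ultimately show False using u_inside t by simp
    qed
    then have "- cball 0 N \<subseteq> C"
      using N by (intro components_maximal[OF C con]) auto
    then show "p \<in> C" using p by auto
  qed
qed

text \<open>A level set is the intersection of the closed sub- and superlevel sets, which are connected and
  cover the plane; it is connected because the plane is unicoherent.\<close>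
lemma connected_level_set:
  assumes t: "t > 0" shows "connected {x. u x = t}"
proof -
  have op: "open {x. u x < t}" "open {x. u x > t}"
    by (intro open_Collect_less cont_u continuous_on_const)+
  have in_closure: "x \<in> closure S"
    if x: "u x = t" and S: "(\<forall>y. y \<notin> S \<longrightarrow> u x \<le> u y) \<or> (\<forall>y. y \<notin> S \<longrightarrow> u y \<le> u x)" for x S
  proof (rule ccontr)
    assume c: "x \<notin> closure S"
    have "- closure S \<subseteq> - S" using closure_subset by blast
    then have "norm x \<le> R" using S c by (intro local_extremum_inside[of "- closure S"]) auto
    then show False using u_inside x t by auto
  qed
  have level: "x \<in> closure {x. u x < t}" "x \<in> closure {x. u x > t}" if x: "u x = t" for x
    by (rule in_closure; simp add: x)+
  have eq: "closure {x. u x < t} = {x. u x \<le> t}" "closure {x. u x > t} = {x. u x \<ge> t}"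
  proof -
    have upper: "closure {x. u x < t} \<subseteq> {x. u x \<le> t}" "closure {x. u x > t} \<subseteq> {x. u x \<ge> t}"
      by (intro closure_minimal closed_Collect_le cont_u continuous_on_const; force)+
    have lower: "x \<in> closure {x. u x < t}" if "u x \<le> t" for x
      using level(1)[of x] subsetD[OF closure_subset, of x "{x. u x < t}"] that by (cases "u x = t") auto
    have lower': "x \<in> closure {x. u x > t}" if "u x \<ge> t" for x
      using level(2)[of x] subsetD[OF closure_subset, of x "{x. u x > t}"] that by (cases "u x = t") auto
    show "closure {x. u x < t} = {x. u x \<le> t}" "closure {x. u x > t} = {x. u x \<ge> t}"
      using upper lower lower' by blast+
  qed
  have "connected ({x. u x \<le> t} \<inter> {x. u x \<ge> t})"
  proof (rule unicoherentD[OF unicoherent_UNIV])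
    show "connected {x. u x \<le> t}" "connected {x. u x \<ge> t}"
      using connected_imp_connected_closure[OF connected_sublevel[OF t]]
        connected_imp_connected_closure[OF connected_superlevel[OF t]] eq by simp_all
    show "closedin (top_of_set UNIV) {x. u x \<le> t}" "closedin (top_of_set UNIV) {x. t \<le> u x}"
      using eq by (auto simp flip: eq simp: closedin_closed_eq)
  qed auto
  moreover have "{x. u x \<le> t} \<inter> {x. u x \<ge> t} = {x. u x = t}" by auto
  ultimately show ?thesis by simp
qed

lemma vorticity_constant_on_level_sets:
  assumes "u x = t" "u y = t" "t > 0"
  shows "\<omega> x = \<omega> y"
proof -
  have "\<omega> constant_on {x. u x = t}"
  proof (rule locally_constant_imp_constant[OF connected_level_set[OF \<open>t > 0\<close>]])
    fix z assume z: "z \<in> {x. u x = t}"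
    have "a z \<noteq> 0" using critical_iff[of z] u_inside[of z] z \<open>t > 0\<close> by auto
    then obtain d where d: "d > 0" "\<forall>y\<in>ball z d. u y = u z \<longrightarrow> \<omega> y = \<omega> z"
      using first_integral_locally_constant[OF grad cont_a vort_deriv transport, of z] by blast
    show "\<exists>T. openin (top_of_set {x. u x = t}) T \<and> z \<in> T \<and> (\<forall>x\<in>T. \<omega> x = \<omega> z)"
    proof (intro exI conjI ballI)
      show "openin (top_of_set {x. u x = t}) ({x. u x = t} \<inter> ball z d)" by (rule openin_open_Int) simp
      show "z \<in> {x. u x = t} \<inter> ball z d" using z d by simp
      show "\<omega> x = \<omega> z" if "x \<in> {x. u x = t} \<inter> ball z d" for x
        using that z d(2)[rule_format, of x] by simp
    qed
  qed
  then obtain c where "\<forall>z\<in>{x. u x = t}. \<omega> z = c" unfolding constant_on_def by (elim exE)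
  then show ?thesis using assms by simp
qed

text \<open>By the previous lemma the vorticity is a function of \<open>u\<close> outside the disk. That function is
  Lipschitz near \<open>t > 0\<close>, as is seen by following a segment in the gradient direction through a
  point at level \<open>t\<close>, on which \<open>u\<close> grows at least linearly.\<close>
lemma vorticity_Lipschitz_in_stream_function:
  assumes t: "t > 0"
  shows "\<exists>d>0. \<exists>L. \<forall>x y. \<bar>u x - t\<bar> < d \<longrightarrow> \<bar>u y - t\<bar> < d \<longrightarrow> \<bar>\<omega> x - \<omega> y\<bar> \<le> L * \<bar>u x - u y\<bar>"
proof -
  obtain N where N: "\<And>x. norm x > N \<Longrightarrow> u x > t" using u_tends_to_infinity by blast
  define w where "w = (\<bar>N\<bar> + 1) *\<^sub>R (axis 1 1 :: real^2)"
  have "u w > t" by (rule N) (simp add: w_def)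
  then have "\<exists>x. u x = t"
    using connected_ivt_hyperplane[OF connected_continuous_image[OF cont_u connected_UNIV], of 0 "u w" 1 t] t u_zero
    by auto
  then obtain x0 where x0: "u x0 = t" by blast
  define n where "n = norm (a x0)"
  have "a x0 \<noteq> 0" using critical_iff[of x0] u_inside[of x0] x0 t by auto
  then have n: "n > 0" by (simp add: n_def)
  define e where "e = a x0 /\<^sub>R n"
  have ee: "norm e = 1" "a x0 = n *\<^sub>R e" "e \<bullet> e = 1" using n
    by (auto simp: e_def n_def power2_norm_eq_inner[symmetric] power2_eq_square field_simps)
  obtain r where r: "r > 0" "\<And>z. dist z x0 < r \<Longrightarrow> dist (a z) (a x0) < n / 2"
    using cont_a[of UNIV] n unfolding continuous_on_iff by (metis UNIV_I half_gt_zero)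
  obtain k L where k: "k > 0" "\<And>y z. y \<in> ball x0 k \<Longrightarrow> z \<in> ball x0 k \<Longrightarrow> \<bar>\<omega> y - \<omega> z\<bar> \<le> L * norm (y - z)"
    using vort_Lipschitz[of x0] by blast
  define \<rho> where "\<rho> = min r k / 2"
  have \<rho>: "\<rho> > 0" "\<rho> < r" "\<rho> < k" using r k by (auto simp: \<rho>_def)
  define z where "z = (\<lambda>s. x0 + s *\<^sub>R e)"
  have dz: "dist (z s) x0 = \<bar>s\<bar>" for s using ee by (simp add: z_def dist_norm)
  have uz: "((\<lambda>s. u (z s)) has_real_derivative a (z s) \<bullet> e) (at s)" for s
    unfolding z_def by (rule has_real_derivative_along_line[OF grad])
  have slope: "a (z s) \<bullet> e \<ge> n / 2" if "\<bar>s\<bar> \<le> \<rho>" for s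
  proof -
    have "norm (a (z s) - n *\<^sub>R e) < n / 2" using r(2)[of "z s"] that \<rho> dz ee by (simp add: dist_norm)
    then have "\<bar>(a (z s) - n *\<^sub>R e) \<bullet> e\<bar> < n / 2" using Cauchy_Schwarz_ineq2[of "a (z s) - n *\<^sub>R e" e] ee by simp
    moreover have "(a (z s) - n *\<^sub>R e) \<bullet> e = a (z s) \<bullet> e - n" using ee by (simp add: inner_diff_left)
    ultimately show ?thesis by linarith
  qed
  have expand: "u (z s') - u (z s) \<ge> n / 2 * (s' - s)" if s: "- \<rho> \<le> s" "s \<le> s'" "s' \<le> \<rho>" for s s'
  proof (cases "s = s'")
    case False
    then have "s < s'" using s by simp
    then obtain \<xi> where \<xi>: "s < \<xi>" "\<xi> < s'" "u (z s') - u (z s) = (s' - s) * (a (z \<xi>) \<bullet> e)"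
      using MVT2[of s s' "\<lambda>s. u (z s)" "\<lambda>s. a (z s) \<bullet> e"] uz by blast
    have "(s' - s) * (n / 2) \<le> (s' - s) * (a (z \<xi>) \<bullet> e)"
      using slope[of \<xi>] \<xi> s by (intro mult_left_mono) auto
    then show ?thesis using \<xi>(3) by (simp add: mult.commute)
  qed simp
  \<comment> \<open>Every level within \<open>n \<rho> / 2\<close> of \<open>t\<close> is attained on the segment; \<open>d \<le> t\<close> keeps the levels positive.\<close>
  define d where "d = min t (n / 2 * \<rho>)"
  have d: "d > 0" using t n \<rho> by (simp add: d_def)
  have "z 0 = x0" by (simp add: z_def)
  then have ends: "u (z (- \<rho>)) \<le> t - n / 2 * \<rho>" "u (z \<rho>) \<ge> t + n / 2 * \<rho>"
    using expand[of "- \<rho>" 0] expand[of 0 \<rho>] \<rho> x0 by auto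
  have reach: "\<exists>s. \<bar>s\<bar> \<le> \<rho> \<and> u (z s) = u x \<and> \<omega> (z s) = \<omega> x" if x: "\<bar>u x - t\<bar> < d" for x
  proof -
    have "continuous_on {- \<rho>..\<rho>} (\<lambda>s. u (z s))"
      by (intro continuous_at_imp_continuous_on ballI DERIV_isCont[OF uz])
    moreover have "\<bar>u x - t\<bar> < n / 2 * \<rho>" using x unfolding d_def by linarith
    then have "u (z (- \<rho>)) \<le> u x" "u x \<le> u (z \<rho>)" using ends by linarith+
    ultimately obtain s where s: "- \<rho> \<le> s" "s \<le> \<rho>" "u (z s) = u x"
      using IVT'[of "\<lambda>s. u (z s)" "- \<rho>" "u x" \<rho>] \<rho> by auto
    have "u x > 0" using x by (auto simp: d_def)
    then have "\<omega> (z s) = \<omega> x" using vorticity_constant_on_level_sets[OF s(3)] by simp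
    then show ?thesis using s by (intro exI[of _ s]) auto
  qed
  have "\<bar>\<omega> x - \<omega> y\<bar> \<le> \<bar>L\<bar> * (2 / n) * \<bar>u x - u y\<bar>" if xy: "\<bar>u x - t\<bar> < d" "\<bar>u y - t\<bar> < d" for x y
  proof -
    obtain s s' where s: "\<bar>s\<bar> \<le> \<rho>" "u (z s) = u x" "\<omega> (z s) = \<omega> x"
      "\<bar>s'\<bar> \<le> \<rho>" "u (z s') = u y" "\<omega> (z s') = \<omega> y" using reach[OF xy(1)] reach[OF xy(2)] by blast
    have "n / 2 * \<bar>s - s'\<bar> \<le> \<bar>u x - u y\<bar>"
    proof (cases "s \<le> s'")
      case True
      then have "n / 2 * (s' - s) \<le> u (z s') - u (z s)" using s by (intro expand) auto
      then show ?thesis using True s abs_ge_minus_self[of "u x - u y"] by simp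
    next
      case False
      then have "n / 2 * (s - s') \<le> u (z s) - u (z s')" using s by (intro expand) auto
      then show ?thesis using False s abs_ge_self[of "u x - u y"] by simp
    qed
    then have ss: "\<bar>s - s'\<bar> \<le> 2 / n * \<bar>u x - u y\<bar>" using n by (simp add: field_simps)
    have "\<bar>\<omega> x - \<omega> y\<bar> \<le> L * norm (z s - z s')"
      using k(2)[of "z s" "z s'"] s \<rho> dz by (simp add: dist_commute)
    also have "norm (z s - z s') = \<bar>s - s'\<bar>"
      using ee by (simp add: z_def flip: scaleR_diff_left)
    also have "L * \<bar>s - s'\<bar> \<le> \<bar>L\<bar> * \<bar>s - s'\<bar>" by (intro mult_right_mono) auto
    also have "\<dots> \<le> \<bar>L\<bar> * (2 / n * \<bar>u x - u y\<bar>)" using ss by (intro mult_left_mono) auto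
    finally show ?thesis by simp
  qed
  then show ?thesis using d by blast
qed

text \<open>Near the disk the reflected point lies either in the disk, where \<open>u = 0\<close>, or in the annulus where
  the level curves are nearly circles. Near infinity it lies either in that part of the plane,
  or in a fixed bounded set on which \<open>u\<close> takes smaller values.\<close>
lemma reflection_decreases_at_ends:
  assumes e: "norm e = 1" and m: "m > 0"
  shows "\<exists>d>0. \<exists>M. \<forall>l\<ge>m. \<forall>x. x \<bullet> e > l \<longrightarrow>
       (R < norm x \<and> norm x < R + d) \<or> norm x > M \<longrightarrow> u (reflection e l x) < u x"
proof -
  define \<eta> where "\<eta> = min m R / 8"
  have \<eta>: "\<eta> > 0" "8 * \<eta> \<le> m" "8 * \<eta> \<le> R" using m R_pos by (auto simp: \<eta>_def)
  obtain d where d: "d > 0" "\<And>x. R < norm x \<Longrightarrow> norm x < R + d \<Longrightarrow>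
      a x \<bullet> x > 0 \<and> norm x * \<bar>a x \<bullet> rot90 x\<bar> \<le> \<eta> * (a x \<bullet> x)"
    using angular_near[OF \<eta>(1)] by blast
  obtain M0 where M0: "\<And>x. norm x > M0 \<Longrightarrow>
      a x \<bullet> x > 0 \<and> norm x * \<bar>a x \<bullet> rot90 x\<bar> \<le> \<eta> * (a x \<bullet> x)"
    using angular_far[OF \<eta>(1)] by blast
  define M1 where "M1 = max M0 R"
  obtain B where B: "\<And>x. norm x \<le> M1 \<Longrightarrow> u x \<le> B"
    using continuous_attains_sup[OF compact_cball _ cont_u, of "0::real^2" M1] R_pos
    by (metis M1_def cball_eq_empty max.strict_coboundedI2 mem_cball_0 not_less_iff_gr_or_eq)
  obtain N where N: "\<And>x. norm x > N \<Longrightarrow> u x > B" using u_tends_to_infinity by blast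
  have *: "u (reflection e l x) < u x"
    if l: "m \<le> l" and x: "x \<bullet> e > l" and ends: "(R < norm x \<and> norm x < R + d) \<or> norm x > max N M1" for l x
  proof -
    define y where "y = reflection e l x"
    have "(norm y)\<^sup>2 < (norm x)\<^sup>2"
      using norm_reflection_sq[OF e, of l x] l m x by (simp add: y_def)
    then have less: "norm y < norm x" by (rule power_less_imp_less_base) simp
    have near: "u y < u x"
      if yR: "norm y > R" and ann: "\<And>z. norm y \<le> norm z \<Longrightarrow> norm z \<le> norm x \<Longrightarrow>
         a z \<bullet> z > 0 \<and> norm z * \<bar>a z \<bullet> rot90 z\<bar> \<le> \<eta> * (a z \<bullet> z)"
      by (rule reflection_decreases_near_ends[OF grad e _ x y_def, of \<eta>])
        (use yR ann \<eta> l m R_pos in auto)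
    consider "norm y \<le> R" | "norm y > R" "R < norm x" "norm x < R + d" | "norm y \<le> M1" "norm x > max N M1"
      | "norm y > M1" using ends by linarith
    then show ?thesis
    proof cases
      case 1
      have "norm x > R" using ends by (auto simp: M1_def)
      then show ?thesis using u_outside[of x] u_inside[OF 1] by (simp add: y_def)
    next
      case 2
      then show ?thesis using near d by (simp add: y_def)
    next
      case 3
      then show ?thesis using B[of y] N[of x] by (simp add: y_def)
    next
      case 4
      then show ?thesis using near M0 by (simp add: y_def M1_def)
    qed
  qed
  show ?thesis using d * by blast
qed

sublocale moving_plane u a A R
proof
  show "\<exists>d>0. \<exists>L. \<forall>x y. \<bar>u x - t\<bar> < d \<longrightarrow> \<bar>u y - t\<bar> < d \<longrightarrow>
       \<bar>(\<Sum>b\<in>Basis. A x b \<bullet> b) - (\<Sum>b\<in>Basis. A y b \<bullet> b)\<bar> \<le> L * \<bar>u x - u y\<bar>" if "t > 0" for t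
    using vorticity_Lipschitz_in_stream_function[OF that] by (simp add: vort)
qed (fact grad hess R_pos u_inside u_outside reflection_decreases_at_ends)+

lemma gradient_radial:
  assumes x: "norm x > R"
  defines "r \<equiv> norm x"
  shows "a x = (a (r *\<^sub>R axis 1 1) $ 1) *\<^sub>R (x /\<^sub>R r)" and "a (r *\<^sub>R axis 1 1) $ 1 > 0"
proof -
  have r: "r > R" "r > 0" using x R_pos by (auto simp: r_def)
  define e where "e = x /\<^sub>R r"
  have "x \<noteq> 0" using r by (auto simp: r_def)
  then have e: "norm e = 1" "x = r *\<^sub>R e" using r by (auto simp: e_def r_def)
  define E where "E = (axis 1 1 :: real^2)"
  have E: "norm E = 1" by (simp add: E_def)
  have radial: "((\<lambda>s. u (s *\<^sub>R f)) has_real_derivative a (r *\<^sub>R f) \<bullet> f) (at r)" for f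
    using has_real_derivative_along_line[of u "\<lambda>h. a (r *\<^sub>R f) \<bullet> h" 0 r f] grad by simp
  have "((\<lambda>s. u (s *\<^sub>R e)) has_real_derivative a (r *\<^sub>R E) \<bullet> E) (at r)"
  proof (rule has_field_derivative_transform_within_open[OF radial[of E], of "{R<..}"])
    show "u (s *\<^sub>R E) = u (s *\<^sub>R e)" if "s \<in> {R<..}" for s
      using that R_pos e E by (intro radially_symmetric) auto
  qed (use r in auto)
  then have ae: "a x \<bullet> e = a (r *\<^sub>R E) \<bullet> E"
    using DERIV_unique[OF radial[of e]] e(2) by metis
  have aE: "a (r *\<^sub>R E) \<bullet> E = a (r *\<^sub>R E) $ 1" by (simp add: E_def inner_axis)
  have tangential: "a x \<bullet> rot90 x = 0"
  proof -
    define q where "q = (\<lambda>t. cos t *\<^sub>R x + sin t *\<^sub>R rot90 x)"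
    have nq: "norm (q t) = r" for t
    proof -
      have 1: "(sin t)\<^sup>2 + (cos t)\<^sup>2 = 1" by simp
      have "q t \<bullet> q t = ((sin t)\<^sup>2 + (cos t)\<^sup>2) * (x \<bullet> x)"
      proof -
        have "q t $ 1 = cos t * x $ 1 - sin t * x $ 2" "q t $ 2 = cos t * x $ 2 + sin t * x $ 1"
          by (simp_all add: q_def)
        then show ?thesis unfolding inner_real2 by algebra
      qed
      then show ?thesis unfolding 1 by (simp add: r_def norm_eq)
    qed
    have "(q has_derivative (\<lambda>t. t *\<^sub>R rot90 x)) (at 0)"
      unfolding q_def by (auto intro!: derivative_eq_intros simp: fun_eq_iff)
    from has_derivative_compose[OF this grad]
    have "((\<lambda>t. u (q t)) has_derivative (\<lambda>t. a x \<bullet> (t *\<^sub>R rot90 x))) (at 0)" by (simp add: q_def)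
    moreover have "(\<lambda>t. u (q t)) = (\<lambda>t. u x)"
      using nq r by (intro ext radially_symmetric) (auto simp: r_def)
    ultimately have "(\<lambda>t::real. a x \<bullet> (t *\<^sub>R rot90 x)) = (\<lambda>t. 0)"
      using has_derivative_unique[OF _ has_derivative_const] by metis
    then have "a x \<bullet> (1 *\<^sub>R rot90 x) = 0" by (rule fun_cong)
    then show ?thesis by simp
  qed
  then have t0: "a x $ 2 * e $ 1 = a x $ 1 * e $ 2"
    using r by (simp add: e(2) inner_real2)
  have ee: "e $ 1 * e $ 1 + e $ 2 * e $ 2 = 1" using e(1) by (simp add: norm_eq_1 inner_real2)
  have "a x $ 1 = (a x \<bullet> e) * e $ 1" "a x $ 2 = (a x \<bullet> e) * e $ 2"
    using t0 ee unfolding inner_real2 by algebra+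
  then have "a x = (a x \<bullet> e) *\<^sub>R e" by (simp add: vec_eq_iff forall_2)
  then show eq: "a x = (a (r *\<^sub>R axis 1 1) $ 1) *\<^sub>R (x /\<^sub>R r)"
    using ae aE by (simp add: e_def E_def)
  have "a x \<noteq> 0" using critical_iff[of x] x by simp
  then have "a (r *\<^sub>R E) $ 1 \<noteq> 0" using eq by (auto simp: E_def)
  moreover have "\<not> a (r *\<^sub>R E) \<bullet> E < 0"
  proof
    assume "a (r *\<^sub>R E) \<bullet> E < 0"
    then obtain d where d: "d > 0" "\<And>h. 0 < h \<Longrightarrow> h < d \<Longrightarrow> u ((r + h) *\<^sub>R E) < u (r *\<^sub>R E)"
      using DERIV_neg_dec_right[OF radial[of E]] by blast
    have "u ((r + d / 2) *\<^sub>R E) < u (r *\<^sub>R E)" using d by simp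
    moreover have "u (r *\<^sub>R E) < u ((r + d / 2) *\<^sub>R E)"
      using d by (intro increasing_along_rays[OF E r(1)]) simp
    ultimately show False by linarith
  qed
  ultimately show "a (r *\<^sub>R axis 1 1) $ 1 > 0" using aE by (simp add: E_def)
qed

end

section \<open>Steady Euler flows\<close>

lemma C_k_on_subset: "C_k_on k f S \<Longrightarrow> T \<subseteq> S \<Longrightarrow> C_k_on k f T"
  by (induction k arbitrary: f) (auto intro: continuous_on_subset)

lemma C_k_on_component_along_ray:
  fixes f :: "real^2 \<Rightarrow> real^2"
  assumes "C_k_on k f UNIV"
  shows "C_k_on k (\<lambda>r::real. f (r *\<^sub>R w) $ i) UNIV"
  using assms
proof (induction k arbitrary: f)
  case 0
  then have "continuous_on UNIV f" by simp
  then show ?case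
    by (auto intro!: continuous_intros continuous_on_compose2[of UNIV f])
next
  case (Suc k)
  then have f: "(f has_derivative frechet_derivative f (at x)) (at x)" for x
    using frechet_derivative_works by auto
  have "((\<lambda>r. f (r *\<^sub>R w)) has_derivative (\<lambda>h. frechet_derivative f (at (r *\<^sub>R w)) (h *\<^sub>R w))) (at r)" for r :: real
    by (rule has_derivative_compose[OF _ f]) (auto intro!: derivative_eq_intros)
  then have d: "((\<lambda>r. f (r *\<^sub>R w) $ i) has_derivative (\<lambda>h. frechet_derivative f (at (r *\<^sub>R w)) (h *\<^sub>R w) $ i)) (at r)" for r :: real
    by (rule bounded_linear.has_derivative[OF bounded_linear_vec_nth])
  have "C_k_on k (\<lambda>r. frechet_derivative f (at (r *\<^sub>R w)) (h *\<^sub>R w) $ i) UNIV" for h :: real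
    using Suc by (intro Suc.IH[of "\<lambda>x. frechet_derivative f (at x) (h *\<^sub>R w)"]) auto
  then show ?case
    using d by (auto simp: differentiable_def frechet_derivative_at[OF d, symmetric])
qed

lemma C2_fieldE:
  fixes v :: "real^2 \<Rightarrow> real^2"
  assumes "C_k_on 2 v UNIV"
  obtains D D2 where "\<And>x. (v has_derivative D x) (at x)"
    "\<And>x h. ((\<lambda>x. D x h) has_derivative D2 x h) (at x)"
    "\<And>h k. continuous_on UNIV (\<lambda>x. D2 x h k)"
    "\<And>x h k. D2 x h k = D2 x k h"
    "\<And>x. D x = frechet_derivative v (at x)"
proof -
  define D where "D = (\<lambda>x. frechet_derivative v (at x))"
  define D2 where "D2 = (\<lambda>x h. frechet_derivative (\<lambda>x. D x h) (at x))"
  have D: "(v has_derivative D x) (at x)" for x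
    using assms frechet_derivative_works by (auto simp: numeral_2_eq_2 D_def)
  have D2: "((\<lambda>x. D x h) has_derivative D2 x h) (at x)" for x h
    unfolding D2_def using assms by (intro iffD1[OF frechet_derivative_works]) (auto simp: numeral_2_eq_2 D_def)
  have cont: "continuous_on UNIV (\<lambda>x. D2 x h k)" for h k
    using assms by (auto simp: numeral_2_eq_2 D_def D2_def)
  have "D2 x h k = D2 x k h" for x h k
  proof -
    have "D2 x h k $ i = D2 x k h $ i" for i
      by (rule mixed_derivatives_commute[where f = "\<lambda>x. v x $ i" and f' = "\<lambda>x h. D x h $ i"
            and ?D1.0 = "\<lambda>x k. D2 x h k $ i" and ?D2.0 = "\<lambda>x h. D2 x k h $ i"])
        (intro bounded_linear.has_derivative[OF bounded_linear_vec_nth] D D2 continuous_intros cont)+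
    then show ?thesis by (simp add: vec_eq_iff)
  qed
  then show thesis by (intro that[of D D2] D D2 cont) (simp_all add: D_def)
qed

lemma expand_axis: "(h::real^2) = h $ 1 *\<^sub>R axis 1 1 + h $ 2 *\<^sub>R axis 2 1"
  by (simp add: vec_eq_iff forall_2 axis_def)

lemma linear_expand_axis:
  assumes "linear f" shows "f (h::real^2) = h $ 1 *\<^sub>R f (axis 1 1) + h $ 2 *\<^sub>R f (axis 2 1)"
  by (subst expand_axis[of h]) (simp only: linear_add[OF assms] linear_scale[OF assms])

lemma sum_Basis_real2: "(\<Sum>b\<in>(Basis::(real^2) set). f b) = f (axis 1 1) + f (axis 2 1)"
proof -
  have Basis_eq: "(Basis::(real^2) set) = {axis 1 1, axis 2 1}"
    by (auto simp: Basis_vec_def UNIV_2)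
  show ?thesis unfolding Basis_eq by (simp add: axis_eq_axis)
qed

lemma angular_velocity_rot90: "norm x * angular_velocity v x = v x \<bullet> rot90 x"
  by (cases "x = 0") (simp_all add: angular_velocity_def e_theta_def inner_real2 field_simps)

lemma radial_velocity_inner: "norm x * radial_velocity v x = v x \<bullet> x"
  by (cases "x = 0") (simp_all add: radial_velocity_def e_r_def)

lemma inner_neg_rot90:
  "(- rot90 w) \<bullet> z = w \<bullet> rot90 z" "(- rot90 w) \<bullet> rot90 z = - (w \<bullet> z)"
  by (simp_all add: inner_real2)

lemma bounded_linear_rot90: "bounded_linear rot90"
proof -
  have "linear rot90" by (rule linearI) (simp_all add: vec_eq_iff forall_2)
  then show ?thesis by (simp add: linear_conv_bounded_linear)
qed

text \<open>Taking the curl of the Euler equation removes the pressure and yields \<open>v \<bullet> \<nabla>\<omega> = 0\<close>. Here \<open>N\<close> is the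
  convective term \<open>v \<bullet> \<nabla>v\<close>, and \<open>N'\<close> its derivative.\<close>
lemma vorticity_transported:
  fixes v :: "real^2 \<Rightarrow> real^2"
  assumes euler: "classical_Euler_solution v p"
    and D: "\<And>x. (v has_derivative D x) (at x)"
    and D2: "\<And>x h. ((\<lambda>x. D x h) has_derivative D2 x h) (at x)"
    and cont: "\<And>h k. continuous_on UNIV (\<lambda>x. D2 x h k)"
    and sym: "\<And>x h k. D2 x h k = D2 x k h"
    and D_eq: "\<And>x. D x = frechet_derivative v (at x)"
  shows "D x (axis 1 1) $ 1 + D x (axis 2 1) $ 2 = 0"
    and "D2 x (axis 1 1) (v x) $ 2 - D2 x (axis 2 1) (v x) $ 1 = 0"
proof -
  define e1 :: "real^2" where "e1 = axis 1 1"
  define e2 :: "real^2" where "e2 = axis 2 1"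
  have div: "D x e1 $ 1 + D x e2 $ 2 = 0" for x
    using euler by (auto simp: classical_Euler_solution_def divergence_def partial_deriv_def sum_2 D_eq e1_def e2_def)
  then show "D x (axis 1 1) $ 1 + D x (axis 2 1) $ 2 = 0" by (simp add: e1_def e2_def)
  define N where "N = (\<lambda>x. v x $ 1 *\<^sub>R D x e1 + v x $ 2 *\<^sub>R D x e2)"
  define N' where "N' = (\<lambda>x k. (v x $ 1 *\<^sub>R D2 x e1 k + D x k $ 1 *\<^sub>R D x e1)
      + (v x $ 2 *\<^sub>R D2 x e2 k + D x k $ 2 *\<^sub>R D x e2))"
  have N': "(N has_derivative N' x) (at x)" for x
    unfolding N_def N'_def
    by (intro has_derivative_add has_derivative_scaleR D2
        bounded_linear.has_derivative[OF bounded_linear_vec_nth] D)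
  have cv: "continuous_on UNIV v"
    by (rule continuous_on_if_has_derivative[OF D])
  have cD: "continuous_on UNIV (\<lambda>x. D x h)" for h
    by (rule continuous_on_if_has_derivative[OF D2])
  have cN': "continuous_on UNIV (\<lambda>x. N' x k)" for k
    unfolding N'_def by (intro continuous_intros cv cD cont)
  define P where "P = (\<lambda>x. frechet_derivative p (at x))"
  have P: "(p has_derivative P x) (at x)" for x
    unfolding P_def using euler by (intro iffD1[OF frechet_derivative_works]) (auto simp: classical_Euler_solution_def)
  have "N x + gradient p x = 0" for x
    using euler by (auto simp: classical_Euler_solution_def convection_def partial_deriv_def sum_2 D_eq N_def e1_def e2_def)
  then have "N x $ i + gradient p x $ i = 0" for x i by (metis vector_add_component zero_index)
  then have P_N: "P x (axis i 1) = - (N x $ i)" for x i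
    by (simp add: gradient_def partial_deriv_def P_def add_eq_0_iff)
  have "- (N' x e2 $ 1) = - (N' x e1 $ 2)"
  proof (rule mixed_derivatives_commute[OF P, where ?D1.0 = "\<lambda>x k. - (N' x k $ 1)" and ?D2.0 = "\<lambda>x k. - (N' x k $ 2)"])
    show "((\<lambda>x. P x e1) has_derivative (\<lambda>k. - (N' x k $ 1))) (at x)" for x
      unfolding e1_def P_N by (intro has_derivative_minus bounded_linear.has_derivative[OF bounded_linear_vec_nth] N')
    show "((\<lambda>x. P x e2) has_derivative (\<lambda>k. - (N' x k $ 2))) (at x)" for x
      unfolding e2_def P_N by (intro has_derivative_minus bounded_linear.has_derivative[OF bounded_linear_vec_nth] N')
  qed (intro continuous_intros cN')+
  moreover have "D2 x h (v x) = v x $ 1 *\<^sub>R D2 x h e1 + v x $ 2 *\<^sub>R D2 x h e2" for h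
    unfolding e1_def e2_def by (rule linear_expand_axis[OF has_derivative_linear[OF D2]])
  moreover have "D2 x e2 e1 = D2 x e1 e2" by (rule sym)
  moreover have "D x e2 $ 2 = - (D x e1 $ 1)" using div[of x] by linarith
  ultimately show "D2 x (axis 1 1) (v x) $ 2 - D2 x (axis 2 1) (v x) $ 1 = 0"
    by (simp add: N'_def algebra_simps flip: e1_def e2_def)
qed

lemma C1_locally_Lipschitz:
  fixes f :: "real^2 \<Rightarrow> real"
  assumes f: "\<And>x. (f has_derivative F x) (at x)" and cont: "\<And>h. continuous_on UNIV (\<lambda>x. F x h)"
  shows "\<exists>d>0. \<exists>L. \<forall>y\<in>ball x d. \<forall>z\<in>ball x d. \<bar>f y - f z\<bar> \<le> L * norm (y - z)"
proof -
  have "continuous_on (cball x 1) (\<lambda>y. \<bar>F y (axis 1 1)\<bar> + \<bar>F y (axis 2 1)\<bar>)"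
    by (intro continuous_intros continuous_on_subset[OF cont]) auto
  then obtain m where m: "\<And>y. y \<in> cball x 1 \<Longrightarrow> \<bar>F y (axis 1 1)\<bar> + \<bar>F y (axis 2 1)\<bar> \<le> m"
    using continuous_attains_sup[of "cball x 1" "\<lambda>y. \<bar>F y (axis 1 1)\<bar> + \<bar>F y (axis 2 1)\<bar>"] by force
  have on: "onorm (F y) \<le> m" if y: "y \<in> ball x 1" for y
  proof (rule onorm_le)
    fix h :: "real^2"
    have "\<bar>F y h\<bar> \<le> \<bar>h $ 1\<bar> * \<bar>F y (axis 1 1)\<bar> + \<bar>h $ 2\<bar> * \<bar>F y (axis 2 1)\<bar>"
      using linear_expand_axis[OF has_derivative_linear[OF f[of y]], of h]
        abs_triangle_ineq[of "h $ 1 * F y (axis 1 1)" "h $ 2 * F y (axis 2 1)"] by (simp add: abs_mult)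
    also have "\<dots> \<le> norm h * \<bar>F y (axis 1 1)\<bar> + norm h * \<bar>F y (axis 2 1)\<bar>"
      by (intro add_mono mult_right_mono component_le_norm_cart) auto
    also have "\<dots> = norm h * (\<bar>F y (axis 1 1)\<bar> + \<bar>F y (axis 2 1)\<bar>)" by (simp add: algebra_simps)
    also have "\<dots> \<le> norm h * m" using y by (intro mult_left_mono m) auto
    finally show "norm (F y h) \<le> m * norm h" by (simp add: mult.commute)
  qed
  have "norm (f y - f z) \<le> m * norm (y - z)" if "y \<in> ball x 1" "z \<in> ball x 1" for y z
    using that by (intro differentiable_bound[OF convex_ball has_derivative_at_withinI[OF f] on]) auto
  then have "\<forall>y\<in>ball x 1. \<forall>z\<in>ball x 1. \<bar>f y - f z\<bar> \<le> m * norm (y - z)" by simp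
  then show ?thesis using zero_less_one by blast
qed

theorem theorem1p5:
  fixes v :: "real^2 \<Rightarrow> real^2" and p :: "real^2 \<Rightarrow> real" and R :: real
  assumes "C_k_on 2 v UNIV"
    and "classical_Euler_solution v p"
    and "R > 0"
    and "stagnation_set v = cball 0 R"
    and "Liminf at_infinity (\<lambda>x. ereal (angular_velocity v x)) > 0"
    and "radial_velocity v \<in> o[at_infinity](\<lambda>x. 1 / norm x)"
    and "\<exists>\<delta>>0. \<forall>x. R < norm x \<and> norm x < R + \<delta> \<longrightarrow> angular_velocity v x > 0"
    and "radial_velocity v \<in> o[filtercomap norm (at_right R)](angular_velocity v)"
  shows "\<exists>V :: real \<Rightarrow> real. C_k_on 2 V {R<..} \<and> (\<forall>r>R. V r > 0) \<and>
           (\<forall>x. norm x > R \<longrightarrow> v x = V (norm x) *\<^sub>R e_theta x)"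
proof -
  obtain D D2 where D: "\<And>x. (v has_derivative D x) (at x)"
    and D2: "\<And>x h. ((\<lambda>x. D x h) has_derivative D2 x h) (at x)"
    and cD2: "\<And>h k. continuous_on UNIV (\<lambda>x. D2 x h k)"
    and sym: "\<And>x h k. D2 x h k = D2 x k h"
    and D_eq: "\<And>x. D x = frechet_derivative v (at x)"
    using C2_fieldE[OF assms(1)] by metis
  note div = vorticity_transported(1)[OF assms(2) D D2 cD2 sym D_eq]
  note trans = vorticity_transported(2)[OF assms(2) D D2 cD2 sym D_eq]
  \<comment> \<open>The gradient of the stream function is \<open>(v\<^sub>2, -v\<^sub>1)\<close>.\<close>
  define a where "a = (\<lambda>x. - rot90 (v x))"
  define A where "A = (\<lambda>x h. - rot90 (D x h))"
  define \<omega> where "\<omega> = (\<lambda>x. D x (axis 1 1) $ 2 - D x (axis 2 1) $ 1)"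
  define W where "W = (\<lambda>x k. D2 x (axis 1 1) k $ 2 - D2 x (axis 2 1) k $ 1)"
  have hess: "(a has_derivative A x) (at x)" for x
    unfolding a_def A_def by (intro has_derivative_minus bounded_linear.has_derivative[OF bounded_linear_rot90] D)
  have D_expand: "D x h = h $ 1 *\<^sub>R D x (axis 1 1) + h $ 2 *\<^sub>R D x (axis 2 1)" for x h
    by (rule linear_expand_axis[OF has_derivative_linear[OF D]])
  have symA: "A x h \<bullet> k = A x k \<bullet> h" for x h k
  proof -
    have "D x (axis 2 1) $ 2 = - (D x (axis 1 1) $ 1)" using div[of x] by linarith
    then show ?thesis
      unfolding A_def by (subst D_expand[of x h], subst D_expand[of x k]) (simp add: inner_real2 algebra_simps)
  qed
  have cD: "continuous_on UNIV (\<lambda>x. D x h)" for h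
    by (rule continuous_on_if_has_derivative[OF D2])
  have contA: "continuous_on UNIV (\<lambda>(x, h). A x h)"
  proof -
    have cD1: "continuous_on UNIV (\<lambda>z. D (fst z) h)" for h
      by (rule continuous_on_compose2[OF cD continuous_on_fst[OF continuous_on_id]]) auto
    have "continuous_on UNIV (\<lambda>z. - rot90 (snd z $ 1 *\<^sub>R D (fst z) (axis 1 1) + snd z $ 2 *\<^sub>R D (fst z) (axis 2 1)))"
      by (intro continuous_intros bounded_linear.continuous_on[OF bounded_linear_rot90] cD1)
    moreover have "(\<lambda>(x, h). A x h) = (\<lambda>z. - rot90 (snd z $ 1 *\<^sub>R D (fst z) (axis 1 1) + snd z $ 2 *\<^sub>R D (fst z) (axis 2 1)))"
      by (auto simp: fun_eq_iff A_def D_expand[symmetric])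
    ultimately show ?thesis by simp
  qed
  obtain u where u: "u 0 = 0" "\<And>x. (u has_derivative (\<lambda>h. a x \<bullet> h)) (at x)"
    using gradient_of_symmetric_derivative[OF hess contA symA] by blast
  have a_radial: "a x \<bullet> x = norm x * angular_velocity v x" for x
    by (simp only: a_def inner_neg_rot90 angular_velocity_rot90)
  have a_angular: "\<bar>a x \<bullet> rot90 x\<bar> = norm x * \<bar>radial_velocity v x\<bar>" for x
    by (simp only: a_def inner_neg_rot90(2) radial_velocity_inner[symmetric] abs_minus_cancel abs_mult abs_norm_cancel)
  obtain c where c: "c > 0" "eventually (\<lambda>x. c < angular_velocity v x) at_infinity"
  proof -
    obtain c where "0 < ereal c" "ereal c < Liminf at_infinity (\<lambda>x. ereal (angular_velocity v x))"
      using ereal_dense2[OF assms(5)] by auto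
    then show ?thesis
      using that[of c] less_LiminfD[of "ereal c" at_infinity "\<lambda>x. ereal (angular_velocity v x)"] by simp
  qed
  have v0: "v x = 0 \<longleftrightarrow> norm x \<le> R" for x
  proof -
    have "x \<in> stagnation_set v \<longleftrightarrow> x \<in> cball 0 R" using assms(4) by simp
    then show ?thesis by (simp add: stagnation_set_def)
  qed
  interpret exterior_stream_function u a A \<omega> W R
  proof
    show "\<omega> x = (\<Sum>b\<in>Basis. A x b \<bullet> b)" for x
      by (simp add: \<omega>_def A_def sum_Basis_real2 inner_axis)
    show W: "(\<omega> has_derivative W x) (at x)" for x
      unfolding \<omega>_def W_def
      by (intro has_derivative_diff bounded_linear.has_derivative[OF bounded_linear_vec_nth] D2)
    have "continuous_on UNIV (\<lambda>x. W x h)" for h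
      unfolding W_def by (intro continuous_intros cD2)
    then show "\<exists>d>0. \<exists>L. \<forall>y\<in>ball x d. \<forall>z\<in>ball x d. \<bar>\<omega> y - \<omega> z\<bar> \<le> L * norm (y - z)" for x
      by (rule C1_locally_Lipschitz[OF W])
    show "W x h = 0" if "a x \<noteq> 0" "a x \<bullet> h = 0" for x h
    proof -
      define s where "s = v x $ 1 * v x $ 1 + v x $ 2 * v x $ 2"
      have s: "s \<noteq> 0" using that(1) by (auto simp: s_def a_def vec_eq_iff forall_2 sum_squares_eq_zero_iff)
      have "v x $ 2 * h $ 1 = v x $ 1 * h $ 2" using that(2) by (simp add: a_def inner_real2)
      then have "s * h $ 1 = (h \<bullet> v x) * v x $ 1" "s * h $ 2 = (h \<bullet> v x) * v x $ 2"
        unfolding s_def inner_real2 by algebra+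
      then have "s *\<^sub>R h = (h \<bullet> v x) *\<^sub>R v x" by (simp add: vec_eq_iff forall_2)
      then have "W x (s *\<^sub>R h) = W x ((h \<bullet> v x) *\<^sub>R v x)" by simp
      then have "s * W x h = (h \<bullet> v x) * W x (v x)"
        by (simp add: linear_scale[OF has_derivative_linear[OF W]])
      then show ?thesis using trans[of x] s by (simp add: W_def)
    qed
    show "R > 0" by fact
    show "a x = 0 \<longleftrightarrow> norm x \<le> R" for x
      unfolding v0[symmetric] by (auto simp: a_def vec_eq_iff forall_2)
    show "\<exists>c>0. \<exists>M. \<forall>x. norm x > M \<longrightarrow> a x \<bullet> x \<ge> c * norm x"
    proof -
      obtain M where "\<And>x. norm x \<ge> M \<Longrightarrow> c < angular_velocity v x"
        using c(2) unfolding eventually_at_infinity by blast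
      then have "c * norm x \<le> a x \<bullet> x" if "norm x > M" for x
        using that mult_right_mono[of c "angular_velocity v x" "norm x"]
        by (simp add: a_radial mult.commute less_imp_le)
      then show ?thesis using c(1) by blast
    qed
    fix \<eta> :: real assume \<eta>: "\<eta> > 0"
    show "\<exists>d>0. \<forall>x. R < norm x \<and> norm x < R + d \<longrightarrow>
          a x \<bullet> x > 0 \<and> norm x * \<bar>a x \<bullet> rot90 x\<bar> \<le> \<eta> * (a x \<bullet> x)"
    proof -
      obtain d where d: "d > 0" "\<And>x. R < norm x \<Longrightarrow> norm x < R + d \<Longrightarrow> angular_velocity v x > 0"
        using assms(7) by blast
      have "\<eta> / (2 * R) > 0" using \<eta> \<open>R > 0\<close> by simp
      from landau_o.smallD[OF assms(8) this]
      obtain b where b: "b > R" "\<And>x. R < norm x \<Longrightarrow> norm x < b \<Longrightarrow>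
          \<bar>radial_velocity v x\<bar> \<le> \<eta> / (2 * R) * \<bar>angular_velocity v x\<bar>"
        unfolding eventually_filtercomap eventually_at_right_field by fastforce
      define k where "k = min d (min (b - R) R)"
      have k: "k > 0" using d b \<open>R > 0\<close> by (simp add: k_def)
      have "a x \<bullet> x > 0 \<and> norm x * \<bar>a x \<bullet> rot90 x\<bar> \<le> \<eta> * (a x \<bullet> x)" if x: "R < norm x" "norm x < R + k" for x
      proof -
        have pos: "angular_velocity v x > 0" "norm x > 0" using d(2)[of x] x \<open>R > 0\<close> by (auto simp: k_def)
        have "norm x * \<bar>a x \<bullet> rot90 x\<bar> = norm x * norm x * \<bar>radial_velocity v x\<bar>" by (simp add: a_angular)
        also have "\<dots> \<le> norm x * norm x * (\<eta> / (2 * R) * angular_velocity v x)"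
          using b(2)[of x] x pos by (intro mult_left_mono) (auto simp: k_def)
        also have "\<dots> = (norm x / (2 * R)) * (\<eta> * (a x \<bullet> x))" by (simp add: a_radial)
        also have "\<dots> \<le> 1 * (\<eta> * (a x \<bullet> x))"
          using x pos \<eta> \<open>R > 0\<close> by (intro mult_right_mono) (auto simp: k_def a_radial)
        finally show ?thesis using pos by (simp add: a_radial)
      qed
      then show ?thesis using k by blast
    qed
    show "\<exists>M. \<forall>x. norm x > M \<longrightarrow>
          a x \<bullet> x > 0 \<and> norm x * \<bar>a x \<bullet> rot90 x\<bar> \<le> \<eta> * (a x \<bullet> x)"
    proof -
      have "\<eta> * c > 0" using \<eta> c by simp
      from eventually_conj[OF c(2) landau_o.smallD[OF assms(6) this]]
      obtain M where M: "\<And>x. norm x \<ge> M \<Longrightarrow> c < angular_velocity v x \<and>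
          \<bar>radial_velocity v x\<bar> \<le> \<eta> * c * \<bar>1 / norm x\<bar>"
        unfolding eventually_at_infinity by auto
      have "a x \<bullet> x > 0 \<and> norm x * \<bar>a x \<bullet> rot90 x\<bar> \<le> \<eta> * (a x \<bullet> x)" if x: "norm x > max M 0" for x
      proof -
        have pos: "c < angular_velocity v x" "norm x > 0" "x \<noteq> 0" using M[of x] x by auto
        have "norm x * \<bar>a x \<bullet> rot90 x\<bar> = norm x * norm x * \<bar>radial_velocity v x\<bar>" by (simp add: a_angular)
        also have "\<dots> \<le> norm x * norm x * (\<eta> * c * \<bar>1 / norm x\<bar>)"
          using M[of x] x by (intro mult_left_mono) auto
        also have "\<dots> = \<eta> * (norm x * c)" using pos by simp
        also have "\<dots> \<le> \<eta> * (a x \<bullet> x)"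
          using pos \<eta> by (simp add: a_radial)
        finally show ?thesis using pos c by (simp add: a_radial)
      qed
      then show ?thesis by blast
    qed
  qed (fact hess u)+
  define V where "V = (\<lambda>r. v (r *\<^sub>R axis 1 1) $ 2)"
  have aV: "a (r *\<^sub>R axis 1 1) $ 1 = V r" for r by (simp add: a_def V_def)
  show ?thesis
  proof (intro exI[of _ V] conjI allI impI)
    show "C_k_on 2 V {R<..}"
      unfolding V_def by (rule C_k_on_subset[OF C_k_on_component_along_ray[OF assms(1)]]) simp
    show "V r > 0" if "r > R" for r
      using gradient_radial(2)[of "r *\<^sub>R axis 1 1"] that \<open>R > 0\<close> by (simp add: aV)
    show "v x = V (norm x) *\<^sub>R e_theta x" if x: "norm x > R" for x
    proof -
      have "v x = rot90 (a x)" by (simp add: a_def vec_eq_iff forall_2)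
      also have "\<dots> = rot90 (V (norm x) *\<^sub>R (x /\<^sub>R norm x))" using gradient_radial(1)[OF x] by (simp add: aV)
      also have "\<dots> = V (norm x) *\<^sub>R e_theta x"
        by (simp add: vec_eq_iff forall_2 e_theta_def divide_inverse mult.commute)
      finally show ?thesis .
    qed
  qed
qed

end
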